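(* The smallest constant $C$ such that $$\mathbb{E}\big[\deg(X;\omega)^2\big]\le C$$ holds for every finite, simple, connected, regular graph $G=(V,E)$, where $\omega$ is a sample of the uniform spanning tree on $G$ and the vertex $X$ is chosen uniformly at random from $V$ independently of $\omega$, is $C=6$. Equivalently, the supremum of $\mathbb{E}[\deg(X;\omega)^2]$ over all finite, simple, connected, regular graphs $G$ equals $6$.
   Context: The uniform spanning tree (UST) on a finite connected graph $G$ is a random spanning tree distributed uniformly on the set of all spanning trees of $G$. $\deg(X;\omega)$ denotes the degree of $X$ in the spanning tree $\omega$. A graph is regular if all its vertices have the same degree. *)

theory Defs
  imports "HOL-Probability.Probability"
begin

text \<open>
  A graph is given by its vertex set \<open>V\<close> and its edge set \<open>E\<close>, edges being unordered pairs
  (two-element sets) of distinct vertices; so loops and multiple edges cannot occur.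
\<close>

definition finite_simple_graph :: "'a set \<Rightarrow> 'a set set \<Rightarrow> bool" where
  "finite_simple_graph V E \<longleftrightarrow>
     finite V \<and> V \<noteq> {} \<and> E \<subseteq> {{u, v} | u v. u \<in> V \<and> v \<in> V \<and> u \<noteq> v}"

definition connected_graph :: "'a set \<Rightarrow> 'a set set \<Rightarrow> bool" where
  "connected_graph V E \<longleftrightarrow> (\<forall>u\<in>V. \<forall>v\<in>V. (u, v) \<in> {(x, y). {x, y} \<in> E}\<^sup>*)"

definition degree :: "'a set set \<Rightarrow> 'a \<Rightarrow> nat" where
  "degree E v = card {e \<in> E. v \<in> e}"

definition regular_graph :: "'a set \<Rightarrow> 'a set set \<Rightarrow> bool" where
  "regular_graph V E \<longleftrightarrow> (\<exists>d. \<forall>v\<in>V. degree E v = d)"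

text \<open>
  A cycle is listed by its vertices, the first one not being repeated at the end; the closing edge
  is the one obtained for \<open>i = length c - 1\<close>.
\<close>

definition is_cycle :: "'a set set \<Rightarrow> 'a list \<Rightarrow> bool" where
  "is_cycle E c \<longleftrightarrow>
     3 \<le> length c \<and> distinct c \<and> (\<forall>i<length c. {c ! i, c ! (Suc i mod length c)} \<in> E)"

definition acyclic_graph :: "'a set set \<Rightarrow> bool" where
  "acyclic_graph E \<longleftrightarrow> (\<nexists>c. is_cycle E c)"

text \<open>A spanning tree of \<open>(V, E)\<close> has vertex set \<open>V\<close>, so it is identified with its edge set.\<close>

definition spanning_trees :: "'a set \<Rightarrow> 'a set set \<Rightarrow> 'a set set set" where
  "spanning_trees V E = {T. T \<subseteq> E \<and> connected_graph V T \<and> acyclic_graph T}"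

definition ust :: "'a set \<Rightarrow> 'a set set \<Rightarrow> 'a set set pmf" where
  "ust V E = pmf_of_set (spanning_trees V E)"

text \<open>
  The second moment of the degree of \<open>X\<close> in \<open>\<omega>\<close>; taking the product distribution makes the uniform
  vertex \<open>X\<close> independent of the uniform spanning tree \<open>\<omega>\<close>.
\<close>

definition ust_degree_second_moment :: "'a set \<Rightarrow> 'a set set \<Rightarrow> real" where
  "ust_degree_second_moment V E =
     measure_pmf.expectation (pair_pmf (ust V E) (pmf_of_set V)) (\<lambda>(\<omega>, X). (real (degree \<omega> X))\<^sup>2)"

definition finite_simple_connected_regular :: "'a set \<Rightarrow> 'a set set \<Rightarrow> bool" where
  "finite_simple_connected_regular V E \<longleftrightarrow>
     finite_simple_graph V E \<and> connected_graph V E \<and> regular_graph V E"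

end

theory Submission
  imports Defs "HOL-Library.Transitive_Closure_Table" "HOL-Real_Asymp.Real_Asymp"
begin

text \<open>
  Ground the graph at a vertex \<open>v\<close> of degree \<open>d\<close> and let \<open>g\<close> be the Green function of the grounded
  Laplacian. For neighbours \<open>x \<noteq> y\<close> of \<open>v\<close>, the edge \<open>vx\<close> lies in the random tree with probability
  \<open>g x x\<close>, and both \<open>vx\<close> and \<open>vy\<close> do with probability \<open>g x x * g y y - (g x y)\<^sup>2\<close>. The matrix \<open>g\<close>
  restricted to the neighbours fixes the all-ones vector, so the squares of its entries sum to at least
  1 and the second moment of the degree is at most \<open>m + m\<^sup>2 - 1\<close>, where \<open>m\<close> is its mean. The means sum to
  \<open>2 * (n - 1)\<close>. By the variational principle every edge has probability at least \<open>2 / (d + 1)\<close>; the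
  sum of the excesses over this value is at most \<open>n / (d + 1)\<close>, and orienting the edges of each tree shows
  that the squared means then sum to at most \<open>5 * n\<close>. Hence the bound \<open>5 + 2 - 1 = 6\<close>.

  For sharpness, attach \<open>d\<close> almost complete blocks with \<open>d + 2\<close> vertices each to a hub by bridges. The
  hub has degree \<open>d\<close> in every tree and contributes \<open>d\<^sup>2\<close>, about as much as the number \<open>(d + 1)\<^sup>2\<close> of
  vertices, whereas in the blocks the spectral gap makes the second moments about \<open>2 + 4 - 1 = 5\<close>.
\<close>

subsection \<open>Spanning trees and two-component forests\<close>

definition reach :: "'a set set \<Rightarrow> ('a \<times> 'a) set" where
  "reach T = {(x, y). {x, y} \<in> T}\<^sup>*"

lemma reach_refl [simp]: "(x, x) \<in> reach T"
  by (simp add: reach_def)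

lemma reach_edge: "{x, y} \<in> T \<Longrightarrow> (x, y) \<in> reach T"
  unfolding reach_def by blast

lemma reach_trans: "(x, y) \<in> reach T \<Longrightarrow> (y, z) \<in> reach T \<Longrightarrow> (x, z) \<in> reach T"
  unfolding reach_def by (rule rtrancl_trans)

lemma reach_sym: "(x, y) \<in> reach T \<Longrightarrow> (y, x) \<in> reach T"
proof -
  have "sym {(x, y). {x, y} \<in> T}"
    by (auto simp: sym_def insert_commute)
  then show "(x, y) \<in> reach T \<Longrightarrow> (y, x) \<in> reach T"
    unfolding reach_def by (meson sym_rtrancl symD)
qed

lemma reach_mono: "S \<subseteq> T \<Longrightarrow> (x, y) \<in> reach S \<Longrightarrow> (x, y) \<in> reach T"
  unfolding reach_def by (rule subsetD[OF rtrancl_mono]) auto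

lemma reach_induct [consumes 1, case_names refl step]:
  assumes "(a, b) \<in> reach T" "P a"
    "\<And>x y. (a, x) \<in> reach T \<Longrightarrow> {x, y} \<in> T \<Longrightarrow> P x \<Longrightarrow> P y"
  shows "P b"
  using assms(1) unfolding reach_def
  by (induction rule: rtrancl_induct) (use assms(2,3) in \<open>auto simp: reach_def\<close>)

text \<open>A walk can be shortened so that it crosses the new edge at most once; the last two
  disjuncts are the two directions of crossing.\<close>

lemma reach_insert:
  assumes "(a, b) \<in> reach (insert {z, u} F)"
  shows "(a, b) \<in> reach F \<or> (a, z) \<in> reach F \<and> (u, b) \<in> reach F
    \<or> (a, u) \<in> reach F \<and> (z, b) \<in> reach F"
  using assms
proof (induction rule: reach_induct)
  case (step x y)
  show ?case
  proof (cases "{x, y} = {z, u}")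
    case True
    then have "x = z \<and> y = u \<or> x = u \<and> y = z"
      by (auto simp: doubleton_eq_iff)
    then show ?thesis
      using step.IH by auto
  next
    case False
    then have "(x, y) \<in> reach F"
      using step.hyps by (intro reach_edge) auto
    then show ?thesis
      using step.IH by (meson reach_trans)
  qed
qed simp

text \<open>Cycle-freeness recast as "every edge is a bridge": reachability is easier to follow
  under deletion and insertion of edges than lists of cycle vertices.\<close>

definition bridged :: "'a set set \<Rightarrow> bool" where
  "bridged T \<longleftrightarrow> (\<forall>a b. {a, b} \<in> T \<longrightarrow> (a, b) \<notin> reach (T - {{a, b}}))"

lemma bridgedD: "bridged T \<Longrightarrow> {a, b} \<in> T \<Longrightarrow> (a, b) \<notin> reach (T - {{a, b}})"
  by (auto simp: bridged_def)

lemma bridged_imp_acyclic: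
  assumes "bridged T"
  shows "acyclic_graph T"
  unfolding acyclic_graph_def
proof
  assume "\<exists>c. is_cycle T c"
  then obtain c where c: "3 \<le> length c" "distinct c"
      "\<And>i. i < length c \<Longrightarrow> {c ! i, c ! (Suc i mod length c)} \<in> T"
    by (auto simp: is_cycle_def)
  define n where "n = length c - 1"
  have n: "length c = Suc n" "2 \<le> n"
    using c(1) by (auto simp: n_def)
  have closing: "{c ! 0, c ! n} \<in> T"
    using c(3)[of n] n by (simp add: insert_commute)
  have "i \<le> n \<Longrightarrow> (c ! 0, c ! i) \<in> reach (T - {{c ! 0, c ! n}})" for i
  proof (induction i)
    case (Suc i)
    have "{c ! i, c ! Suc i} \<in> T"
      using c(3)[of i] Suc.prems n by simp
    moreover have "{c ! i, c ! Suc i} \<noteq> {c ! 0, c ! n}"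
      using c(2) n Suc.prems by (auto simp: doubleton_eq_iff nth_eq_iff_index_eq)
    ultimately have "(c ! i, c ! Suc i) \<in> reach (T - {{c ! 0, c ! n}})"
      by (intro reach_edge) auto
    then show ?case
      using Suc by (meson Suc_leD reach_trans)
  qed simp
  then show False
    using bridgedD[OF assms closing] by blast
qed

text \<open>A detour around the edge, made simple, has at least two steps and closes up to a cycle.
  Loops are excluded separately because cycles have length at least 3.\<close>

lemma acyclic_imp_bridged:
  assumes acyc: "acyclic_graph T" and loopless: "\<And>a. {a} \<notin> T"
  shows "bridged T"
  unfolding bridged_def
proof (intro allI impI notI)
  fix a b assume ab: "{a, b} \<in> T" and r: "(a, b) \<in> reach (T - {{a, b}})"
  define R where "R x y \<longleftrightarrow> {x, y} \<in> T - {{a, b}}" for x y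
  have "R\<^sup>*\<^sup>* a b"
    using r unfolding reach_def R_def rtranclp_rtrancl_eq .
  then obtain ys where "rtrancl_path R a ys b"
    by (auto simp: rtranclp_eq_rtrancl_path)
  then obtain xs where xs: "rtrancl_path R a xs b" "distinct (a # xs)"
    using rtrancl_path_distinct by metis
  have "a \<noteq> b"
    using ab loopless by auto
  have "xs \<noteq> []"
    using xs(1) \<open>a \<noteq> b\<close> by (auto elim: rtrancl_path.cases)
  then have last: "last xs = b"
    using rtrancl_path_last[OF xs(1)] by simp
  have step: "{(a # xs) ! i, xs ! i} \<in> T - {{a, b}}" if "i < length xs" for i
    using rtrancl_path_nth[OF xs(1) that] by (simp add: R_def)
  have len: "2 \<le> length xs"
  proof (rule ccontr)
    assume "\<not> 2 \<le> length xs"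
    with \<open>xs \<noteq> []\<close> have "xs = [b]"
      using last by (cases xs) (auto simp: not_le less_Suc_eq)
    then show False
      using step[of 0] by simp
  qed
  have "is_cycle T (a # xs)"
    unfolding is_cycle_def
  proof (intro conjI allI impI)
    fix i assume i: "i < length (a # xs)"
    show "{(a # xs) ! i, (a # xs) ! (Suc i mod length (a # xs))} \<in> T"
    proof (cases "i < length xs")
      case True
      then show ?thesis
        using step[OF True] by simp
    next
      case False
      then have "i = length xs"
        using i by simp
      moreover have "(a # xs) ! length xs = b"
        using last \<open>xs \<noteq> []\<close> by (metis last_ConsR last_conv_nth length_Cons diff_Suc_1 list.discI)
      ultimately show ?thesis
        using ab by (simp add: insert_commute)
    qed
  qed (use xs len in auto)
  then show False
    using acyc by (auto simp: acyclic_graph_def)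
qed

lemma bridged_subset:
  assumes "bridged T" "S \<subseteq> T"
  shows "bridged S"
  unfolding bridged_def
proof (intro allI impI notI)
  fix a b assume "{a, b} \<in> S" "(a, b) \<in> reach (S - {{a, b}})"
  then show False
    using bridgedD[OF assms(1)] assms(2) reach_mono[of "S - {{a, b}}" "T - {{a, b}}"] by blast
qed

text \<open>A detour around an old edge \<open>ab\<close> would have to use \<open>zu\<close>; its
  two remaining pieces together with \<open>ab\<close> would then connect \<open>z\<close> and
  \<open>u\<close> inside \<open>F\<close>.\<close>

lemma bridged_insert:
  assumes F: "bridged F" and zu: "(z, u) \<notin> reach F"
  shows "bridged (insert {z, u} F)"
  unfolding bridged_def
proof (intro allI impI notI)
  fix a b assume ab: "{a, b} \<in> insert {z, u} F"
    and r: "(a, b) \<in> reach (insert {z, u} F - {{a, b}})"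
  show False
  proof (cases "{a, b} = {z, u}")
    case True
    then have "(a, b) \<in> reach F"
      using r by (elim reach_mono[rotated]) auto
    then show False
      using True zu reach_sym by (fastforce simp: doubleton_eq_iff)
  next
    case False
    then have abF: "{a, b} \<in> F"
      using ab by auto
    have "(a, b) \<in> reach (insert {z, u} (F - {{a, b}}))"
      using r by (elim reach_mono[rotated]) auto
    moreover have "(x, y) \<in> reach F" if "(x, y) \<in> reach (F - {{a, b}})" for x y
      using that by (elim reach_mono[rotated]) auto
    moreover have "(a, b) \<notin> reach (F - {{a, b}})"
      using bridgedD[OF F abF] .
    ultimately show False
      using zu reach_edge[OF abF] by (metis reach_insert reach_sym reach_trans)
  qed
qed

section \<open>Spanning trees of a finite connected graph\<close>

locale fin_conn_graph =
  fixes V :: "'a set" and E :: "'a set set"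
  assumes simple: "finite_simple_graph V E"
    and connected: "connected_graph V E"
begin

abbreviation "sp_trees \<equiv> spanning_trees V E"

lemma finite_V: "finite V"
  using simple by (simp add: finite_simple_graph_def)

lemma V_nonempty: "V \<noteq> {}"
  using simple by (simp add: finite_simple_graph_def)

lemma E_Pow: "E \<subseteq> Pow V"
  using simple by (auto simp: finite_simple_graph_def)

lemma finite_E: "finite E"
  using E_Pow finite_V finite_subset by blast

lemma loopless: "{a} \<notin> E"
  using simple by (auto simp: finite_simple_graph_def)

lemma edgeE:
  assumes "e \<in> E"
  obtains u v where "e = {u, v}" "u \<in> V" "v \<in> V" "u \<noteq> v"
proof -
  have "e \<in> {{u, v} | u v. u \<in> V \<and> v \<in> V \<and> u \<noteq> v}"
    using assms simple unfolding finite_simple_graph_def by blast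
  then show ?thesis
    using that by blast
qed

lemma edge_ends: "{a, b} \<in> E \<Longrightarrow> a \<in> V \<and> b \<in> V \<and> a \<noteq> b"
  using loopless[of a] E_Pow by auto

lemma connected_graph_iff: "connected_graph V T \<longleftrightarrow> (\<forall>u\<in>V. \<forall>v\<in>V. (u, v) \<in> reach T)"
  by (simp add: connected_graph_def reach_def)

lemma tree_iff: "T \<in> sp_trees \<longleftrightarrow> T \<subseteq> E \<and> (\<forall>u\<in>V. \<forall>v\<in>V. (u, v) \<in> reach T) \<and> bridged T"
proof -
  have "acyclic_graph T \<longleftrightarrow> bridged T" if "T \<subseteq> E"
    using that loopless by (meson acyclic_imp_bridged bridged_imp_acyclic subsetD)
  then show ?thesis
    by (auto simp: spanning_trees_def connected_graph_iff)
qed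

lemma tree_subset: "T \<in> sp_trees \<Longrightarrow> T \<subseteq> E"
  by (simp add: tree_iff)

lemma tree_reach: "T \<in> sp_trees \<Longrightarrow> u \<in> V \<Longrightarrow> v \<in> V \<Longrightarrow> (u, v) \<in> reach T"
  by (simp add: tree_iff)

lemma tree_bridged: "T \<in> sp_trees \<Longrightarrow> bridged T"
  by (simp add: tree_iff)

lemma finite_trees: "finite sp_trees"
  by (rule finite_subset[of _ "Pow E"]) (auto simp: tree_iff finite_E)

text \<open>A connected edge set of least size is a tree, since an edge that is not a bridge could
  still be deleted.\<close>

lemma trees_nonempty: "sp_trees \<noteq> {}"
proof -
  let ?P = "\<lambda>T. T \<subseteq> E \<and> (\<forall>u\<in>V. \<forall>v\<in>V. (u, v) \<in> reach T)"
  have "?P E"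
    using connected by (simp add: connected_graph_iff)
  then obtain T where T: "?P T" and min: "\<And>S. ?P S \<Longrightarrow> card T \<le> card S"
    using ex_has_least_nat[of ?P E card] by blast
  have "bridged T"
    unfolding bridged_def
  proof (intro allI impI notI)
    fix a b assume ab: "{a, b} \<in> T" and r: "(a, b) \<in> reach (T - {{a, b}})"
    have "(u, v) \<in> reach (T - {{a, b}})" if "(u, v) \<in> reach T" for u v
    proof -
      have "(u, v) \<in> reach (insert {a, b} (T - {{a, b}}))"
        using that by (elim reach_mono[rotated]) auto
      then show ?thesis
        using reach_insert[of u v a b "T - {{a, b}}"] r by (meson reach_sym reach_trans)
    qed
    then have "?P (T - {{a, b}})"
      using T by blast
    then have "card T \<le> card (T - {{a, b}})"
      by (rule min)
    moreover have "finite T"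
      using T finite_E finite_subset by blast
    ultimately show False
      using ab by (metis card_Diff1_less leD)
  qed
  then show ?thesis
    using T tree_iff by blast
qed

lemma tree_sides:
  assumes T: "T \<in> sp_trees" and zu: "{z, u} \<in> T" and x: "x \<in> V"
  shows "(x, u) \<in> reach (T - {{z, u}}) \<longleftrightarrow> (x, z) \<notin> reach (T - {{z, u}})"
proof -
  have "z \<in> V"
    using zu T tree_subset edge_ends by blast
  then have "(x, z) \<in> reach (insert {z, u} (T - {{z, u}}))"
    using tree_reach[OF T x] zu by (simp add: insert_absorb)
  from reach_insert[OF this]
  have "(x, z) \<in> reach (T - {{z, u}}) \<or> (x, u) \<in> reach (T - {{z, u}})"
    by blast
  moreover have "(z, u) \<notin> reach (T - {{z, u}})"
    using bridgedD[OF tree_bridged[OF T] zu] .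
  ultimately show ?thesis
    by (meson reach_sym reach_trans)
qed

text \<open>The vertex \<open>u\<close> is the first step of the tree path from \<open>z\<close> to
  \<open>x\<close>. Arguing with branches avoids explicit paths in trees.\<close>

lemma tree_branch:
  assumes T: "T \<in> sp_trees" and z: "z \<in> V" and x: "x \<in> V" "x \<noteq> z"
  shows "\<exists>!u. {z, u} \<in> T \<and> (u, x) \<in> reach (T - {{z, u}})"
proof -
  have "(z, x) \<in> reach T"
    using tree_reach[OF T z x(1)] .
  then have "x = z \<or> (\<exists>u. {z, u} \<in> T \<and> (u, x) \<in> reach (T - {{z, u}}))"
  proof (induction rule: reach_induct)
    case (step y x)
    show ?case
    proof (cases "y = z")
      case True
      then show ?thesis
        using step.hyps by auto
    next
      case False
      then obtain u where u: "{z, u} \<in> T" "(u, y) \<in> reach (T - {{z, u}})"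
        using step.IH by auto
      show ?thesis
      proof (cases "{y, x} = {z, u}")
        case True
        then show ?thesis
          using \<open>y \<noteq> z\<close> by (auto simp: doubleton_eq_iff)
      next
        case neq: False
        then have "(y, x) \<in> reach (T - {{z, u}})"
          using step.hyps by (intro reach_edge) auto
        from reach_trans[OF u(2) this] u(1) show ?thesis
          by blast
      qed
    qed
  qed simp
  moreover have "u = u'"
    if u: "{z, u} \<in> T" "(u, x) \<in> reach (T - {{z, u}})"
      and u': "{z, u'} \<in> T" "(u', x) \<in> reach (T - {{z, u'}})" for u u'
  proof (rule ccontr)
    assume "u \<noteq> u'"
    \<comment> \<open>Neither connection to \<open>x\<close> can pass through \<open>z\<close>, so
      both survive the deletion of both edges. Going from \<open>u\<close> via \<open>x\<close> and
      \<open>u'\<close> to \<open>z\<close> then bypasses the bridge \<open>zu\<close>.\<close>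
    define S where "S = T - {{z, u}} - {{z, u'}}"
    have ne: "{z, u} \<noteq> {z, u'}"
      using \<open>u \<noteq> u'\<close> by (auto simp: doubleton_eq_iff)
    have S: "insert {z, u'} S = T - {{z, u}}" "insert {z, u} S = T - {{z, u'}}"
      using u u' ne by (auto simp: S_def)
    have no: "(u, z) \<notin> reach (T - {{z, u}})" "(u', z) \<notin> reach (T - {{z, u'}})"
      using u u' tree_bridged[OF T] bridgedD reach_sym by metis+
    have mono: "(a, b) \<in> reach (T - {{z, u}})" "(a, b) \<in> reach (T - {{z, u'}})"
      if "(a, b) \<in> reach S" for a b
      using that by (auto elim!: reach_mono[rotated] simp: S_def)
    have e: "(u', z) \<in> reach (T - {{z, u}})" "(u, z) \<in> reach (T - {{z, u'}})"
      using S by (auto simp: insert_commute intro!: reach_edge)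
    have "(u, x) \<in> reach S"
      using reach_insert[of u x z u' S] u(2) no e mono unfolding S by (meson reach_trans)
    moreover have "(u', x) \<in> reach S"
      using reach_insert[of u' x z u S] u'(2) no e mono unfolding S by (meson reach_trans)
    ultimately show False
      using no e mono by (meson reach_trans reach_sym)
  qed
  ultimately show ?thesis
    using x by blast
qed

text \<open>Root the tree at \<open>r\<close> and send every other vertex to the edge leading to its
  parent. This yields the number of edges and the orientation used in
  \<open>excess_bound\<close>.\<close>

lemma tree_edge_bij:
  assumes T: "T \<in> sp_trees" and r: "r \<in> V"
  obtains f where "bij_betw f (V - {r}) T" "\<And>z. z \<in> V - {r} \<Longrightarrow> z \<in> f z"
proof -
  define par where "par z = (THE u. {z, u} \<in> T \<and> (u, r) \<in> reach (T - {{z, u}}))" for z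
  have par: "{z, par z} \<in> T \<and> (par z, r) \<in> reach (T - {{z, par z}})" if "z \<in> V - {r}" for z
    unfolding par_def by (rule theI'[OF tree_branch[OF T _ r]]) (use that in auto)
  define f where "f z = {z, par z}" for z
  have "inj_on f (V - {r})"
  proof (rule inj_onI, rule ccontr)
    fix z z' assume z: "z \<in> V - {r}" "z' \<in> V - {r}" "f z = f z'" "z \<noteq> z'"
    then have eq: "par z = z'" "par z' = z"
      by (auto simp: f_def doubleton_eq_iff)
    then have "(z', r) \<in> reach (T - {{z, z'}})" "(z, r) \<in> reach (T - {{z, z'}})" "{z, z'} \<in> T"
      using par[OF z(1)] par[OF z(2)] by (auto simp: insert_commute)
    then show False
      using bridgedD[OF tree_bridged[OF T]] by (meson reach_trans reach_sym)
  qed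
  moreover have "f ` (V - {r}) = T"
  proof
    show "f ` (V - {r}) \<subseteq> T"
      using par by (auto simp: f_def)
    show "T \<subseteq> f ` (V - {r})"
    proof
      fix e assume e: "e \<in> T"
      then obtain z u where zu: "e = {z, u}" "z \<in> V" "u \<in> V"
        using tree_subset[OF T] edgeE by blast
      have main: "{a, b} \<in> f ` (V - {r})"
        if "{a, b} \<in> T" "(b, r) \<in> reach (T - {{a, b}})" "a \<in> V" for a b
      proof -
        have "a \<noteq> r"
          using bridgedD[OF tree_bridged[OF T] that(1)] reach_sym[OF that(2)] by auto
        then have "par a = b"
          unfolding par_def
          by (intro the1_equality tree_branch[OF T that(3) r]) (use that in auto)
        then show ?thesis
          using \<open>a \<noteq> r\<close> that by (auto simp: f_def)
      qed
      show "e \<in> f ` (V - {r})"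
      proof (cases "(r, u) \<in> reach (T - {{z, u}})")
        case True
        then show ?thesis
          using main[of z u] e zu reach_sym[OF True] by simp
      next
        case False
        then have "(r, z) \<in> reach (T - {{z, u}})"
          using tree_sides[OF T _ r] e zu by blast
        from reach_sym[OF this] show ?thesis
          using main[of u z] e zu by (simp add: insert_commute)
      qed
    qed
  qed
  ultimately have "bij_betw f (V - {r}) T"
    by (simp add: bij_betw_def)
  then show ?thesis
    using that[of f] by (auto simp: f_def)
qed

lemma card_tree: "T \<in> sp_trees \<Longrightarrow> card T = card V - 1"
  using tree_edge_bij V_nonempty by (metis bij_betw_same_card card_Diff_singleton ex_in_conv)

text \<open>These are exactly the spanning forests with two components.\<close>

definition forests :: "'a set set set" where
  "forests = {T - {e} | T e. T \<in> sp_trees \<and> e \<in> T}"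

text \<open>Since \<open>F\<close> has exactly two components, any edge of the graph between them
  reconnects it, not only the one that was deleted.\<close>

lemma forest_insert:
  assumes F: "F \<in> forests" and zu: "{z, u} \<in> E" "(z, u) \<notin> reach F"
  shows "insert {z, u} F \<in> sp_trees"
proof -
  obtain T e where T: "T \<in> sp_trees" "e \<in> T" "F = T - {e}"
    using F by (auto simp: forests_def)
  obtain a b where ab: "e = {a, b}"
    using T tree_subset edgeE by blast
  have side: "(x, b) \<in> reach F \<longleftrightarrow> (x, a) \<notin> reach F" if "x \<in> V" for x
    using tree_sides[of T a b x] T ab that by simp
  let ?S = "insert {z, u} F"
  have "(z, u) \<in> reach ?S"
    by (intro reach_edge) simp
  moreover have m: "(x, y) \<in> reach ?S" if "(x, y) \<in> reach F" for x y
    using that by (elim reach_mono[rotated]) auto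
  moreover have "z \<in> V" "u \<in> V"
    using zu edge_ends by auto
  ultimately have "(a, b) \<in> reach ?S"
    using side zu(2) by (meson reach_sym reach_trans)
  then have "(x, a) \<in> reach ?S" if "x \<in> V" for x
    using side[OF that] m by (meson reach_sym reach_trans)
  then have "\<forall>x\<in>V. \<forall>y\<in>V. (x, y) \<in> reach ?S"
    by (meson reach_sym reach_trans)
  moreover have "bridged ?S"
    using T zu(2) tree_bridged bridged_subset[of T F] by (intro bridged_insert) auto
  moreover have "?S \<subseteq> E"
    using T tree_subset zu by blast
  ultimately show ?thesis
    by (simp add: tree_iff)
qed

lemma finite_forests: "finite forests"
proof -
  have "forests \<subseteq> Pow E"
    using tree_subset by (auto simp: forests_def)
  then show ?thesis
    by (rule finite_subset) (simp add: finite_E)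
qed

text \<open>This correspondence exchanges sums over forests that separate an edge's ends for sums
  over trees containing that edge.\<close>

lemma forest_tree_bij:
  assumes zu: "{z, u} \<in> E"
  shows "bij_betw (insert {z, u}) {F \<in> forests. (z, u) \<notin> reach F} {T \<in> sp_trees. {z, u} \<in> T}"
proof (rule bij_betwI[where g = "\<lambda>T. T - {{z, u}}"])
  show "insert {z, u} \<in> {F \<in> forests. (z, u) \<notin> reach F} \<rightarrow> {T \<in> sp_trees. {z, u} \<in> T}"
    using forest_insert zu by auto
  show "(\<lambda>T. T - {{z, u}}) \<in> {T \<in> sp_trees. {z, u} \<in> T} \<rightarrow> {F \<in> forests. (z, u) \<notin> reach F}"
  proof (rule funcsetI)
    fix T assume "T \<in> {T \<in> sp_trees. {z, u} \<in> T}"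
    then have T: "T \<in> sp_trees" "{z, u} \<in> T"
      by auto
    then show "T - {{z, u}} \<in> {F \<in> forests. (z, u) \<notin> reach F}"
      using bridgedD[OF tree_bridged[OF T(1)] T(2)] by (auto simp: forests_def)
  qed
  show "insert {z, u} F - {{z, u}} = F" if "F \<in> {F \<in> forests. (z, u) \<notin> reach F}" for F
    using that reach_edge[of z u F] by auto
  show "insert {z, u} (T - {{z, u}}) = T" if "T \<in> {T \<in> sp_trees. {z, u} \<in> T}" for T
    using that by auto
qed

end

subsection \<open>Green functions and the transfer current formula\<close>

definition laplacian :: "'a set \<Rightarrow> ('a \<Rightarrow> 'a \<Rightarrow> real) \<Rightarrow> ('a \<Rightarrow> real) \<Rightarrow> 'a \<Rightarrow> real" where
  "laplacian V c f z = (\<Sum>u\<in>V. c z u * (f z - f u))"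

text \<open>The Dirichlet form, written as a pairing with the Laplacian so that Green functions can
  be inserted directly; \<open>energy_alt\<close> is the usual symmetric expression.\<close>

definition energy :: "'a set \<Rightarrow> ('a \<Rightarrow> 'a \<Rightarrow> real) \<Rightarrow> ('a \<Rightarrow> real) \<Rightarrow> ('a \<Rightarrow> real) \<Rightarrow> real" where
  "energy V c f h = (\<Sum>z\<in>V. laplacian V c f z * h z)"

text \<open>Summation by parts: average the defining double sum with its copy in which
  \<open>z\<close> and \<open>u\<close> are exchanged.\<close>

lemma energy_alt:
  assumes sym: "\<And>z u. c z u = c u z"
  shows "energy V c f h = (\<Sum>z\<in>V. \<Sum>u\<in>V. c z u * (f z - f u) * (h z - h u)) / 2"
proof -
  have 1: "energy V c f h = (\<Sum>z\<in>V. \<Sum>u\<in>V. c z u * (f z - f u) * h z)"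
    by (simp add: energy_def laplacian_def sum_distrib_right)
  also have "\<dots> = (\<Sum>z\<in>V. \<Sum>u\<in>V. c u z * (f u - f z) * h u)"
    by (subst sum.swap) simp
  finally have "energy V c f h = - (\<Sum>z\<in>V. \<Sum>u\<in>V. c z u * (f z - f u) * h u)"
    using sym by (simp add: sum_negf[symmetric] algebra_simps)
  with 1 show ?thesis
    by (simp add: sum_subtractf right_diff_distrib)
qed

lemma energy_sym:
  assumes "\<And>z u. c z u = c u z"
  shows "energy V c f h = energy V c h f"
  unfolding energy_alt[of c, OF assms] by (simp add: mult_ac)

lemma energy_nonneg:
  assumes "\<And>z u. c z u = c u z" "\<And>z u. 0 \<le> c z u"
  shows "0 \<le> energy V c f f"
proof -
  have "0 \<le> c z u * (f z - f u) * (f z - f u)" for z u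
    using assms(2) by (simp add: mult.assoc)
  then show ?thesis
    unfolding energy_alt[of c, OF assms(1)] by (simp add: sum_nonneg)
qed

lemma energy_diff_left: "energy V c (\<lambda>z. f z - g z) h = energy V c f h - energy V c g h"
proof -
  have "laplacian V c (\<lambda>z. f z - g z) z = laplacian V c f z - laplacian V c g z" for z
    unfolding laplacian_def sum_subtractf[symmetric] by (rule sum.cong) (auto simp: algebra_simps)
  then show ?thesis
    by (simp add: energy_def sum_subtractf left_diff_distrib)
qed

lemma energy_scale_left: "energy V c (\<lambda>z. a * f z) h = a * energy V c f h"
proof -
  have "laplacian V c (\<lambda>z. a * f z) z = a * laplacian V c f z" for z
    unfolding laplacian_def sum_distrib_left by (rule sum.cong) (auto simp: algebra_simps)
  then show ?thesis
    by (simp add: energy_def sum_distrib_left mult.assoc)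
qed

lemma sum_laplacian:
  assumes "\<And>z u. c z u = c u z"
  shows "(\<Sum>z\<in>V. laplacian V c f z) = 0"
  using energy_alt[of c V f "\<lambda>_. 1", OF assms] by (simp add: energy_def)

text \<open>The inverse of the Laplacian with the row and column of \<open>v\<close> deleted,
  extended by 0. The equation is imposed only off the root; what happens at the root follows in
  \<open>sum_root_g\<close>.\<close>

locale green_function =
  fixes V :: "'a set" and c :: "'a \<Rightarrow> 'a \<Rightarrow> real" and v :: 'a and g :: "'a \<Rightarrow> 'a \<Rightarrow> real"
  assumes finite: "finite V" and root: "v \<in> V"
    and c_sym: "c z u = c u z"
    and c_nonneg: "0 \<le> c z u"
    and g_root: "g y v = 0"
    and g_sym: "g y z = g z y"
    and lap_g: "y \<in> V - {v} \<Longrightarrow> z \<in> V - {v} \<Longrightarrow> laplacian V c (g y) z = of_bool (z = y)"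
begin

text \<open>The reproducing property: \<open>\<phi>\<close> vanishes at the root, which is the only
  place where the Laplacian of \<open>g y\<close> is not prescribed.\<close>

lemma energy_g:
  assumes y: "y \<in> V - {v}" and phi: "\<phi> v = 0"
  shows "energy V c (g y) \<phi> = \<phi> y"
proof -
  have "energy V c (g y) \<phi> = (\<Sum>z\<in>V. of_bool (z = y) * \<phi> z)"
    unfolding energy_def
  proof (rule sum.cong)
    show "laplacian V c (g y) z * \<phi> z = of_bool (z = y) * \<phi> z" if "z \<in> V" for z
      using lap_g[OF y, of z] phi that by (cases "z = v") auto
  qed simp
  also have "\<dots> = \<phi> y"
    using y finite by (simp add: of_bool_def if_distrib[of "\<lambda>a. a * _"] cong: if_cong)
  finally show ?thesis .
qed

text \<open>A Laplacian has total 0, so the unit current injected at \<open>y\<close> must leave the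
  network at \<open>v\<close>.\<close>

lemma sum_root_g:
  assumes y: "y \<in> V - {v}"
  shows "(\<Sum>u\<in>V. c v u * g y u) = 1"
proof -
  have "(\<Sum>z\<in>V. laplacian V c (g y) z) = laplacian V c (g y) v + (\<Sum>z\<in>V - {v}. of_bool (z = y))"
    using lap_g[OF y] finite root by (simp add: sum.remove[of V v])
  also have "(\<Sum>z\<in>V - {v}. of_bool (z = y)) = (1 :: real)"
    using y finite by (simp add: of_bool_def)
  also have "laplacian V c (g y) v = - (\<Sum>u\<in>V. c v u * g y u)"
    by (simp add: laplacian_def g_root sum_negf)
  finally show ?thesis
    using sum_laplacian[of c V "g y", OF c_sym] by simp
qed

text \<open>Expanding \<open>0 \<le> energy (\<phi> - t g_y)\<close> at \<open>t = energy \<phi>\<close> avoids dividing by \<open>g y y\<close>.\<close>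

lemma g_diag_ge:
  assumes y: "y \<in> V - {v}" and phi: "\<phi> v = 0" "\<phi> y = 1" and pos: "0 < energy V c \<phi> \<phi>"
  shows "1 / energy V c \<phi> \<phi> \<le> g y y"
proof -
  let ?t = "energy V c \<phi> \<phi>" and ?f = "\<lambda>z. \<phi> z - energy V c \<phi> \<phi> * g y z"
  have "0 \<le> energy V c ?f ?f"
    by (intro energy_nonneg c_sym c_nonneg)
  also have "energy V c ?f ?f = energy V c \<phi> ?f - ?t * energy V c (g y) ?f"
    by (simp only: energy_diff_left energy_scale_left)
  also have "energy V c \<phi> ?f = energy V c ?f \<phi>"
    by (intro energy_sym c_sym)
  also have "\<dots> = ?t - ?t"
    by (simp only: energy_diff_left energy_scale_left energy_g[OF y, of \<phi>, OF phi(1)] phi(2) mult_1_right)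
  also have "energy V c (g y) ?f = 1 - ?t * g y y"
    using energy_g[OF y, of ?f] phi g_root by simp
  finally have "0 \<le> ?t * (?t * g y y - 1)"
    by (simp add: algebra_simps)
  then have "1 \<le> ?t * g y y"
    using pos by (simp add: zero_le_mult_iff)
  then show ?thesis
    using pos by (simp add: field_simps)
qed

end

text \<open>An instance of the Sherman-Morrison formula.\<close>

lemma green_function_update:
  assumes g: "green_function V c v g" and g': "green_function V c' v g'"
    and x: "x \<in> V - {v}"
    and c': "\<And>z u. c' z u = c z u + of_bool (z = v \<and> u = x \<or> z = x \<and> u = v)"
    and y: "y \<in> V - {v}"
  shows "(1 + g x x) * g' y y = (1 + g x x) * g y y - (g x y)\<^sup>2"
proof -
  interpret G: green_function V c v g by (rule g)
  interpret G': green_function V c' v g' by (rule g')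
  \<comment> \<open>On functions vanishing at \<open>v\<close>, an extra unit conductance between
    \<open>v\<close> and \<open>x\<close> is a rank-one perturbation of the form.\<close>
  have upd: "energy V c' f h = energy V c f h + f x * h x" if "f v = 0" "h v = 0" for f h
  proof -
    have "laplacian V c' f z * h z = laplacian V c f z * h z + of_bool (z = x) * (f x * h x)"
      if "z \<in> V" for z
    proof -
      have "laplacian V c' f z = laplacian V c f z
          + (\<Sum>u\<in>V. of_bool (z = v \<and> u = x \<or> z = x \<and> u = v) * (f z - f u))"
        by (simp only: laplacian_def c' distrib_right sum.distrib)
      also have "(\<Sum>u\<in>V. of_bool (z = v \<and> u = x \<or> z = x \<and> u = v) * (f z - f u))
          = (\<Sum>u\<in>V. if u = v then of_bool (z = x) * f x else 0)" if "z \<noteq> v"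
        using that x \<open>f v = 0\<close> by (intro sum.cong) auto
      finally show ?thesis
        using \<open>h v = 0\<close> G.finite G.root by (cases "z = v") (use x in \<open>auto simp: algebra_simps\<close>)
    qed
    then have "energy V c' f h = (\<Sum>z\<in>V. laplacian V c f z * h z + of_bool (z = x) * (f x * h x))"
      unfolding energy_def by (intro sum.cong) auto
    also have "\<dots> = energy V c f h + f x * h x"
      using x G.finite by (simp add: energy_def sum.distrib of_bool_def if_distrib[of "\<lambda>a. a * _"] cong: if_cong)
    finally show ?thesis .
  qed
  \<comment> \<open>Evaluate the new form at \<open>g' y\<close> and \<open>g z\<close> twice, with
    the reproducing property of either Green function.\<close>
  have key: "g z y = g' y z + g' y x * g z x" if z: "z \<in> V - {v}" for z
  proof -
    have "g z y = energy V c' (g' y) (g z)"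
      using G'.energy_g[OF y, of "g z"] G.g_root by simp
    also have "\<dots> = energy V c (g' y) (g z) + g' y x * g z x"
      using upd[of "g' y" "g z"] G.g_root G'.g_root by simp
    also have "energy V c (g' y) (g z) = energy V c (g z) (g' y)"
      by (intro energy_sym G.c_sym)
    also have "\<dots> = g' y z"
      using G.energy_g[OF z, of "g' y"] G'.g_root by simp
    finally show ?thesis .
  qed
  have "g x y = (1 + g x x) * g' y x"
    using key[OF x] by (simp add: algebra_simps)
  moreover have "g y y = g' y y + g' y x * g x y"
    using key[OF y] by (simp add: G.g_sym[of y x])
  ultimately show ?thesis
    by (simp add: algebra_simps power2_eq_square)
qed

section \<open>Kirchhoff's formula and the correlations of edges at a vertex\<close>

context fin_conn_graph
begin

definition conductance :: "('a set \<Rightarrow> real) \<Rightarrow> 'a \<Rightarrow> 'a \<Rightarrow> real" where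
  "conductance w z u = (if {z, u} \<in> E then w {z, u} else 0)"

definition tree_weight :: "('a set \<Rightarrow> real) \<Rightarrow> real" where
  "tree_weight w = (\<Sum>T\<in>sp_trees. prod w T)"

text \<open>Kirchhoff's expression for the inverse of the Laplacian grounded at \<open>v\<close>: the weight of the
  two-component forests separating \<open>y\<close> and \<open>z\<close> from \<open>v\<close>.\<close>

definition green :: "('a set \<Rightarrow> real) \<Rightarrow> 'a \<Rightarrow> 'a \<Rightarrow> 'a \<Rightarrow> real" where
  "green w v y z =
    (\<Sum>F\<in>forests. of_bool ((y, v) \<notin> reach F \<and> (z, v) \<notin> reach F) * prod w F) / tree_weight w"

lemma finite_tree: "T \<in> sp_trees \<Longrightarrow> finite T"
  using tree_subset finite_E finite_subset by blast

lemma tree_weight_pos: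
  assumes "\<And>e. 0 < w e"
  shows "0 < tree_weight w"
  unfolding tree_weight_def using finite_trees trees_nonempty assms
  by (intro sum_pos prod_pos) auto

lemma sum_forests_eq_trees:
  fixes w :: "'a set \<Rightarrow> real"
  assumes zu: "{z, u} \<in> E"
  shows "(\<Sum>F | F \<in> forests \<and> (z, u) \<notin> reach F. w {z, u} * (q F * prod w F))
    = (\<Sum>T\<in>sp_trees. (if {z, u} \<in> T then q (T - {{z, u}}) else 0) * prod w T)"
proof -
  have "(\<Sum>T\<in>sp_trees. (if {z, u} \<in> T then q (T - {{z, u}}) else 0) * prod w T)
      = (\<Sum>T | T \<in> sp_trees \<and> {z, u} \<in> T. q (T - {{z, u}}) * prod w T)"
    by (rule sum.mono_neutral_cong_right) (auto simp: finite_trees split: if_splits)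
  also have "\<dots> = (\<Sum>F | F \<in> forests \<and> (z, u) \<notin> reach F.
      q (insert {z, u} F - {{z, u}}) * prod w (insert {z, u} F))"
    by (rule sum.reindex_bij_betw[OF forest_tree_bij[OF zu], symmetric])
  also have "\<dots> = (\<Sum>F | F \<in> forests \<and> (z, u) \<notin> reach F. w {z, u} * (q F * prod w F))"
  proof (rule sum.cong)
    fix F assume "F \<in> {F. F \<in> forests \<and> (z, u) \<notin> reach F}"
    then have F: "F \<in> forests" "{z, u} \<notin> F"
      using reach_edge[of z u F] by auto
    then have "finite F"
      using finite_tree by (auto simp: forests_def)
    then show "q (insert {z, u} F - {{z, u}}) * prod w (insert {z, u} F)
        = w {z, u} * (q F * prod w F)"
      using F by simp
  qed simp
  finally show ?thesis ..
qed

text \<open>The path of \<open>T\<close> from \<open>y\<close> to \<open>v\<close>, viewed as a unit flow, has divergence \<open>of_bool (z = y)\<close> at \<open>z\<close>;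
  the edge \<open>zu\<close> is used from \<open>z\<close> to \<open>u\<close> iff removing it leaves \<open>y, z\<close> together and \<open>u, v\<close> together.\<close>

lemma tree_flow:
  assumes T: "T \<in> sp_trees" and z: "z \<in> V - {v}" and v: "v \<in> V" and y: "y \<in> V"
  defines "q \<equiv> \<lambda>u F. of_bool ((y, v) \<notin> reach F) *
    (of_bool ((z, v) \<notin> reach F) - of_bool ((u, v) \<notin> reach F) :: real)"
  shows "(\<Sum>u\<in>V. if {z, u} \<in> T then q u (T - {{z, u}}) else 0) = of_bool (z = y)"
proof -
  have vz: "v \<noteq> z" "z \<in> V"
    using z by auto
  have inV: "u \<in> V" if "{z, u} \<in> T" for u
    using that tree_subset[OF T] edge_ends by blast
  obtain u0 where u0: "{z, u0} \<in> T" "\<And>u. {z, u} \<in> T \<Longrightarrow> (u, v) \<in> reach (T - {{z, u}}) \<longleftrightarrow> u = u0"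
    using tree_branch[OF T vz(2) v vz(1)] by blast
  have zv: "(z, v) \<in> reach (T - {{z, u}}) \<longleftrightarrow> u \<noteq> u0" if "{z, u} \<in> T" for u
    using tree_sides[OF T that v] u0(2)[OF that] reach_sym[of z v] reach_sym[of v z]
      reach_sym[of u v] reach_sym[of v u] by blast
  show ?thesis
  proof (cases "y = z")
    case True
    have "(if {z, u} \<in> T then q u (T - {{z, u}}) else 0) = (if u = u0 then 1 else 0)" for u
      using u0 zv[of u] True by (auto simp: q_def)
    then show ?thesis
      using True inV[OF u0(1)] finite_V by simp
  next
    case False
    \<comment> \<open>The path from \<open>y\<close> to \<open>v\<close> enters \<open>z\<close>
      from \<open>u1\<close> and leaves towards \<open>u0\<close>. If \<open>z\<close> is off the
      path, then \<open>u0 = u1\<close> and the contributions cancel.\<close>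
    obtain u1 where u1: "{z, u1} \<in> T" "\<And>u. {z, u} \<in> T \<Longrightarrow> (u, y) \<in> reach (T - {{z, u}}) \<longleftrightarrow> u = u1"
      using tree_branch[OF T vz(2) y False] by blast
    have zy: "(z, y) \<in> reach (T - {{z, u}}) \<longleftrightarrow> u \<noteq> u1" if "{z, u} \<in> T" for u
      using tree_sides[OF T that y] u1(2)[OF that] reach_sym[of z y] reach_sym[of y z]
        reach_sym[of u y] reach_sym[of y u] by blast
    have yv: "(y, v) \<in> reach (T - {{z, u}}) \<longleftrightarrow> (u = u0 \<longleftrightarrow> u = u1)" if "{z, u} \<in> T" for u
      using zv[OF that] zy[OF that] u0(2)[OF that] u1(2)[OF that]
      by (metis reach_sym reach_trans)
    have "(if {z, u} \<in> T then q u (T - {{z, u}}) else 0)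
        = (if u = u0 then 1 else 0) - (if u = u1 then 1 else 0)" for u
      using u0 u1 zv[of u] yv[of u] by (auto simp: q_def)
    then show ?thesis
      using False inV[OF u0(1)] inV[OF u1(1)] finite_V by (simp add: sum_subtractf)
  qed
qed

text \<open>After multiplication by the total tree weight, every edge term becomes a sum over the
  trees through that edge. Exchanging sums leaves, for each tree, the divergence computed in
  \<open>tree_flow\<close>.\<close>

lemma laplacian_green:
  assumes w: "\<And>e. 0 < w e" and v: "v \<in> V" and y: "y \<in> V - {v}" and z: "z \<in> V - {v}"
  shows "laplacian V (conductance w) (green w v y) z = of_bool (z = y)"
proof -
  define q where "q = (\<lambda>u F. of_bool ((y, v) \<notin> reach F) *
    (of_bool ((z, v) \<notin> reach F) - of_bool ((u, v) \<notin> reach F) :: real))"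
  have edge_term: "tree_weight w * (conductance w z u * (green w v y z - green w v y u))
      = (\<Sum>T\<in>sp_trees. (if {z, u} \<in> T then q u (T - {{z, u}}) else 0) * prod w T)" for u
  proof (cases "{z, u} \<in> E")
    case True
    have "tree_weight w * (green w v y z - green w v y u) = (\<Sum>F\<in>forests. q u F * prod w F)"
      using tree_weight_pos[of w, OF w]
      by (simp add: green_def diff_divide_distrib[symmetric] sum_subtractf[symmetric] q_def)
        (intro sum.cong, auto)
    \<comment> \<open>If \<open>F\<close> joins \<open>z\<close> and \<open>u\<close>, both are
      separated from \<open>v\<close> or neither is, and \<open>q\<close> vanishes.\<close>
    also have "\<dots> = (\<Sum>F | F \<in> forests \<and> (z, u) \<notin> reach F. q u F * prod w F)"
    proof (rule sum.mono_neutral_right)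
      show "\<forall>F\<in>forests - {F \<in> forests. (z, u) \<notin> reach F}. q u F * prod w F = 0"
        by (auto simp: q_def) (metis reach_sym reach_trans)+
    qed (auto simp: finite_forests)
    finally have "w {z, u} * (tree_weight w * (green w v y z - green w v y u))
        = (\<Sum>F | F \<in> forests \<and> (z, u) \<notin> reach F. w {z, u} * (q u F * prod w F))"
      by (simp only: sum_distrib_left)
    then have "tree_weight w * (conductance w z u * (green w v y z - green w v y u))
        = (\<Sum>F | F \<in> forests \<and> (z, u) \<notin> reach F. w {z, u} * (q u F * prod w F))"
      using True by (simp add: conductance_def mult.left_commute)
    then show ?thesis
      using sum_forests_eq_trees[OF True, of w "q u"] by simp
  next
    case False
    have "\<not> {z, u} \<in> T" if "T \<in> sp_trees" for T
      using False tree_subset[OF that] by blast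
    then show ?thesis
      using False by (simp add: conductance_def)
  qed
  have "tree_weight w * laplacian V (conductance w) (green w v y) z
      = (\<Sum>u\<in>V. \<Sum>T\<in>sp_trees. (if {z, u} \<in> T then q u (T - {{z, u}}) else 0) * prod w T)"
    by (simp only: laplacian_def sum_distrib_left edge_term)
  also have "\<dots> = (\<Sum>T\<in>sp_trees. (\<Sum>u\<in>V. if {z, u} \<in> T then q u (T - {{z, u}}) else 0) * prod w T)"
    by (subst sum.swap) (simp only: sum_distrib_right)
  also have "\<dots> = (\<Sum>T\<in>sp_trees. of_bool (z = y) * prod w T)"
    using tree_flow[OF _ z v, of _ y] y unfolding q_def by (intro sum.cong) auto
  also have "\<dots> = tree_weight w * of_bool (z = y)"
    by (simp add: tree_weight_def sum_distrib_left[symmetric] mult.commute)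
  finally show ?thesis
    using tree_weight_pos[of w, OF w] by simp
qed

lemma green_function_green:
  assumes w: "\<And>e. 0 < w e" and v: "v \<in> V"
  shows "green_function V (conductance w) v (green w v)"
proof
  show "green w v y z = green w v z y" for y z
    by (simp add: green_def conj_commute)
  show "0 \<le> conductance w z u" for z u
    using w by (simp add: conductance_def less_imp_le)
  show "laplacian V (conductance w) (green w v y) z = of_bool (z = y)"
    if "y \<in> V - {v}" "z \<in> V - {v}" for y z
    by (rule laplacian_green[OF w v that])
qed (auto simp: finite_V v conductance_def green_def insert_commute)

lemma green_diag:
  assumes w: "\<And>e. 0 < w e" and x: "{v, x} \<in> E"
  shows "w {v, x} * green w v x x * tree_weight w = (\<Sum>T | T \<in> sp_trees \<and> {v, x} \<in> T. prod w T)"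
proof -
  have "w {v, x} * green w v x x * tree_weight w
      = (\<Sum>F\<in>forests. w {v, x} * (of_bool ((x, v) \<notin> reach F) * prod w F))"
    using tree_weight_pos[of w, OF w] by (simp add: green_def sum_distrib_left)
  also have "\<dots> = (\<Sum>F | F \<in> forests \<and> (x, v) \<notin> reach F. w {x, v} * (1 * prod w F))"
    by (rule sum.mono_neutral_cong_right) (auto simp: finite_forests insert_commute)
  also have "\<dots> = (\<Sum>T\<in>sp_trees. (if {x, v} \<in> T then 1 else 0) * prod w T)"
    by (rule sum_forests_eq_trees) (use x in \<open>simp add: insert_commute\<close>)
  also have "\<dots> = (\<Sum>T | T \<in> sp_trees \<and> {v, x} \<in> T. prod w T)"
    by (rule sum.mono_neutral_cong_right) (auto simp: finite_trees insert_commute)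
  finally show ?thesis .
qed

definition edge_prob :: "'a set \<Rightarrow> 'a set \<Rightarrow> real" where
  "edge_prob e f = real (card {T \<in> sp_trees. e \<in> T \<and> f \<in> T}) / real (card sp_trees)"

abbreviation "ugreen \<equiv> green (\<lambda>_. 1)"
abbreviation "adj \<equiv> conductance (\<lambda>_. 1)"

lemma ugreen: "v \<in> V \<Longrightarrow> green_function V adj v (ugreen v)"
  by (rule green_function_green) auto

lemma card_trees_pos: "0 < card sp_trees"
  using finite_trees trees_nonempty by (simp add: card_gt_0_iff)

lemma edge_prob_same:
  assumes "{v, x} \<in> E"
  shows "edge_prob {v, x} {v, x} = ugreen v x x"
  using green_diag[of "\<lambda>_. 1", OF _ assms] card_trees_pos
  by (simp add: edge_prob_def tree_weight_def field_simps)

text \<open>Kirchhoff's formula for the tree measure in which trees containing \<open>vx\<close> are counted twice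
  gives the second-order correlation.\<close>

lemma edge_prob_pair:
  assumes x: "{v, x} \<in> E" and y: "{v, y} \<in> E" and xy: "x \<noteq> y"
  shows "edge_prob {v, x} {v, y} = ugreen v x x * ugreen v y y - (ugreen v x y)\<^sup>2"
proof -
  \<comment> \<open>Doubling this weight adds a unit conductance between \<open>v\<close> and
    \<open>x\<close>, which is the situation of \<open>green_function_update\<close>.\<close>
  define w :: "'a set \<Rightarrow> real" where "w e = (if e = {v, x} then 2 else 1)" for e
  have w: "0 < w e" for e
    by (simp add: w_def)
  have V: "v \<in> V" "x \<in> V - {v}" "y \<in> V - {v}"
    using edge_ends[OF x] edge_ends[OF y] by auto
  have wt: "prod w T = 1 + of_bool ({v, x} \<in> T)" if "T \<in> sp_trees" for T
    using finite_tree[OF that] by (simp add: w_def prod.If_cases Int_def cong: conj_cong)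
  have vy: "w {v, y} = 1"
    using xy V by (auto simp: w_def doubleton_eq_iff)
  let ?N = "real (card sp_trees)"
  have N: "0 < ?N"
    using card_trees_pos by simp
  have tw: "tree_weight w = ?N * (1 + ugreen v x x)"
  proof -
    have "tree_weight w = ?N + real (card {T \<in> sp_trees. {v, x} \<in> T})"
      using finite_trees by (simp add: tree_weight_def wt sum.distrib of_bool_def sum.If_cases Int_def)
    then show ?thesis
      using edge_prob_same[OF x] N by (simp add: edge_prob_def field_simps)
  qed
  have "(\<Sum>T | T \<in> sp_trees \<and> {v, y} \<in> T. prod w T)
      = real (card {T \<in> sp_trees. {v, y} \<in> T}) + real (card {T \<in> sp_trees. {v, x} \<in> T \<and> {v, y} \<in> T})"
  proof -
    have "(\<Sum>T | T \<in> sp_trees \<and> {v, y} \<in> T. prod w T)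
        = (\<Sum>T | T \<in> sp_trees \<and> {v, y} \<in> T. 1 + of_bool ({v, x} \<in> T))"
      by (rule sum.cong) (auto simp: wt)
    also have "\<dots> = real (card {T \<in> sp_trees. {v, y} \<in> T})
        + real (card {T \<in> {T \<in> sp_trees. {v, y} \<in> T}. {v, x} \<in> T})"
      using finite_trees by (simp add: sum.distrib of_bool_def sum.If_cases Int_def)
    also have "{T \<in> {T \<in> sp_trees. {v, y} \<in> T}. {v, x} \<in> T} = {T \<in> sp_trees. {v, x} \<in> T \<and> {v, y} \<in> T}"
      by auto
    finally show ?thesis .
  qed
  also have "\<dots> = ?N * (ugreen v y y + edge_prob {v, x} {v, y})"
    using edge_prob_same[OF y, symmetric] N by (simp add: edge_prob_def field_simps)
  finally have "(\<Sum>T | T \<in> sp_trees \<and> {v, y} \<in> T. prod w T)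
      = ?N * (ugreen v y y + edge_prob {v, x} {v, y})" .
  then have "green w v y y * (?N * (1 + ugreen v x x)) = ?N * (ugreen v y y + edge_prob {v, x} {v, y})"
    using green_diag[of w, OF w y] vy tw by simp
  then have "ugreen v y y + edge_prob {v, x} {v, y} = (1 + ugreen v x x) * green w v y y"
    using N by (simp add: mult.commute)
  also have "\<dots> = (1 + ugreen v x x) * ugreen v y y - (ugreen v x y)\<^sup>2"
  proof (rule green_function_update[OF ugreen[OF V(1)] green_function_green[OF w V(1)] V(2) _ V(3)])
    show "conductance w z u = adj z u + of_bool (z = v \<and> u = x \<or> z = x \<and> u = v)" for z u
      using x by (auto simp: conductance_def w_def doubleton_eq_iff insert_commute)
  qed
  finally show ?thesis
    by (simp add: algebra_simps)
qed

end

subsection \<open>The upper bound\<close>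

context fin_conn_graph
begin

definition nb :: "'a \<Rightarrow> 'a set" where
  "nb v = {x. {v, x} \<in> E}"

definition mean_degree :: "'a \<Rightarrow> real" where
  "mean_degree v = (\<Sum>x\<in>nb v. edge_prob {v, x} {v, x})"

definition second_moment :: "'a \<Rightarrow> real" where
  "second_moment v = (\<Sum>T\<in>sp_trees. (real (degree T v))\<^sup>2) / real (card sp_trees)"

lemma nb_subset: "nb v \<subseteq> V - {v}"
  using edge_ends by (auto simp: nb_def)

lemma finite_nb: "finite (nb v)"
  using nb_subset finite_V by (meson finite_Diff finite_subset)

lemma incident_bij: "bij_betw (\<lambda>x. {v, x}) (nb v) {e \<in> E. v \<in> e}"
proof (rule bij_betw_imageI)
  show "inj_on (\<lambda>x. {v, x}) (nb v)"
    by (auto intro!: inj_onI simp: doubleton_eq_iff)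
  show "(\<lambda>x. {v, x}) ` nb v = {e \<in> E. v \<in> e}"
  proof (intro equalityI subsetI)
    fix e assume e: "e \<in> {e \<in> E. v \<in> e}"
    then obtain a b where "e = {a, b}"
      using edgeE by blast
    then have "e = {v, a} \<or> e = {v, b}"
      using e by auto
    then show "e \<in> (\<lambda>x. {v, x}) ` nb v"
      using e by (auto simp: nb_def)
  qed (auto simp: nb_def)
qed

lemma degree_sum:
  assumes "S \<subseteq> E"
  shows "real (degree S v) = (\<Sum>x\<in>nb v. of_bool ({v, x} \<in> S))"
proof -
  have "real (degree S v) = (\<Sum>e | e \<in> E \<and> v \<in> e. of_bool (e \<in> S))"
    using assms finite_E by (simp add: degree_def Int_def conj_ac)
      (metis (no_types, lifting) Collect_cong subsetD)
  then show ?thesis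
    by (simp add: sum.reindex_bij_betw[OF incident_bij, symmetric])
qed

lemma degree_card_nb: "degree E v = card (nb v)"
  unfolding degree_def by (rule bij_betw_same_card[OF incident_bij, symmetric])

lemma ust_degree_second_moment_eq:
  "ust_degree_second_moment V E = (\<Sum>v\<in>V. second_moment v) / real (card V)"
proof -
  have fin: "finite V" "V \<noteq> {}" "finite sp_trees" "sp_trees \<noteq> {}"
    by (simp_all add: finite_V V_nonempty finite_trees trees_nonempty)
  have "pair_pmf (pmf_of_set sp_trees) (pmf_of_set V) = pmf_of_set (sp_trees \<times> V)"
  proof (rule pmf_eqI)
    fix p
    have "sp_trees \<times> V \<noteq> {}" "finite (sp_trees \<times> V)"
      using fin by auto
    then show "pmf (pair_pmf (pmf_of_set sp_trees) (pmf_of_set V)) p = pmf (pmf_of_set (sp_trees \<times> V)) p"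
      by (cases p) (simp add: pmf_pair pmf_of_set fin card_cartesian_product indicator_times)
  qed
  then have "ust_degree_second_moment V E
      = (\<Sum>p\<in>sp_trees \<times> V. (real (degree (fst p) (snd p)))\<^sup>2) / real (card (sp_trees \<times> V))"
    unfolding ust_degree_second_moment_def ust_def
    by (subst integral_pmf_of_set[symmetric]) (use fin in \<open>auto simp: case_prod_unfold\<close>)
  also have "(\<Sum>p\<in>sp_trees \<times> V. (real (degree (fst p) (snd p)))\<^sup>2)
      = (\<Sum>v\<in>V. \<Sum>T\<in>sp_trees. (real (degree T v))\<^sup>2)"
    by (subst sum.swap) (simp add: sum.cartesian_product case_prod_unfold)
  finally show ?thesis
    by (simp add: second_moment_def sum_divide_distrib card_cartesian_product)
qed

lemma second_moment_products:
  "second_moment v = (\<Sum>x\<in>nb v. \<Sum>y\<in>nb v. edge_prob {v, x} {v, y})"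
proof -
  have "(\<Sum>T\<in>sp_trees. (real (degree T v))\<^sup>2)
      = (\<Sum>T\<in>sp_trees. \<Sum>x\<in>nb v. \<Sum>y\<in>nb v. of_bool ({v, x} \<in> T \<and> {v, y} \<in> T))"
    by (rule sum.cong) (simp_all add: degree_sum tree_subset power2_eq_square sum_product of_bool_conj)
  also have "\<dots> = (\<Sum>x\<in>nb v. \<Sum>y\<in>nb v. \<Sum>T\<in>sp_trees. of_bool ({v, x} \<in> T \<and> {v, y} \<in> T))"
    by (subst sum.swap, rule sum.cong[OF refl], rule sum.swap)
  finally show ?thesis
    using finite_trees
    by (simp add: second_moment_def edge_prob_def sum_divide_distrib[symmetric] Int_def)
qed

lemma sum_nb: "v \<in> V \<Longrightarrow> (\<Sum>x\<in>nb v. f x) = (\<Sum>x\<in>V. adj v x * f x)"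
  by (rule sum.mono_neutral_cong_left) (use nb_subset[of v] finite_V in \<open>auto simp: nb_def conductance_def\<close>)

lemma sum_ugreen_nb:
  assumes v: "v \<in> V" and y: "y \<in> nb v"
  shows "(\<Sum>x\<in>nb v. ugreen v x y) = 1"
proof -
  interpret green_function V adj v "ugreen v"
    by (rule ugreen[OF v])
  show ?thesis
    using sum_root_g[of y] y nb_subset[of v] by (simp add: sum_nb[OF v] g_sym[of _ y] subset_iff)
qed

text \<open>The all-ones vector is an eigenvector, with eigenvalue 1, of the Green function
  restricted to the neighbours of the root; the last sum collects the remaining spectrum.\<close>

lemma second_moment_eq:
  assumes v: "v \<in> V" and d: "card (nb v) = d" "0 < d"
  shows "second_moment v = mean_degree v + (mean_degree v)\<^sup>2 - 1
    - (\<Sum>y\<in>nb v. \<Sum>x\<in>nb v. (ugreen v x y - 1 / real d)\<^sup>2)"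
proof -
  let ?g = "ugreen v"
  have m: "mean_degree v = (\<Sum>x\<in>nb v. ?g x x)"
    unfolding mean_degree_def by (rule sum.cong) (auto simp: nb_def edge_prob_same)
  \<comment> \<open>The two-by-two determinant degenerates to 0 for \<open>x = y\<close>, so the
    extra summand restores the diagonal.\<close>
  have "second_moment v = (\<Sum>x\<in>nb v. \<Sum>y\<in>nb v.
      (?g x x * ?g y y - (?g x y)\<^sup>2) + (if x = y then ?g x x else 0))"
    unfolding second_moment_products
    by (intro sum.cong) (auto simp: nb_def edge_prob_same edge_prob_pair power2_eq_square)
  also have "\<dots> = (mean_degree v)\<^sup>2 - (\<Sum>x\<in>nb v. \<Sum>y\<in>nb v. (?g x y)\<^sup>2) + mean_degree v"
    using finite_nb by (simp add: sum.distrib sum_subtractf m power2_eq_square sum_product)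
  also have "(\<Sum>x\<in>nb v. \<Sum>y\<in>nb v. (?g x y)\<^sup>2) = (\<Sum>y\<in>nb v. \<Sum>x\<in>nb v. (?g x y)\<^sup>2)"
    by (rule sum.swap)
  \<comment> \<open>Each column has \<open>d\<close> entries with sum 1, hence mean
    \<open>1 / d\<close>; its variance is split off.\<close>
  also have "\<dots> = (\<Sum>y\<in>nb v. (\<Sum>x\<in>nb v. (?g x y - 1 / real d)\<^sup>2) + 1 / real d)"
  proof (rule sum.cong)
    fix y assume y: "y \<in> nb v"
    have "(\<Sum>x\<in>nb v. (?g x y - 1 / real d)\<^sup>2)
        = (\<Sum>x\<in>nb v. (?g x y)\<^sup>2) - 2 / real d * (\<Sum>x\<in>nb v. ?g x y) + real d * (1 / real d)\<^sup>2"
      by (simp add: power2_diff sum.distrib sum_subtractf sum_distrib_left d mult_ac)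
    also have "real d * (1 / real d)\<^sup>2 = 1 / real d"
      using d by (simp add: power2_eq_square)
    finally show "(\<Sum>x\<in>nb v. (?g x y)\<^sup>2) = (\<Sum>x\<in>nb v. (?g x y - 1 / real d)\<^sup>2) + 1 / real d"
      using sum_ugreen_nb[OF v y] by simp
  qed simp
  also have "\<dots> = (\<Sum>y\<in>nb v. \<Sum>x\<in>nb v. (?g x y - 1 / real d)\<^sup>2) + 1"
    using d by (simp add: sum.distrib)
  finally show ?thesis
    by simp
qed

text \<open>The test function taking the values 0 and 1 at the ends of the edge and 1/2 elsewhere.\<close>

lemma edge_prob_ge:
  assumes reg: "\<And>v. v \<in> V \<Longrightarrow> card (nb v) = d" and vx: "{v, x} \<in> E"
  shows "2 / (real d + 1) \<le> edge_prob {v, x} {v, x}"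
proof -
  have V: "v \<in> V" "x \<in> V - {v}"
    using edge_ends[OF vx] by auto
  interpret green_function V adj v "ugreen v"
    by (rule ugreen[OF V(1)])
  \<comment> \<open>The test function minus 1/2: it lives only on the two ends, so only the
    Laplacian there enters the energy.\<close>
  define \<psi> :: "'a \<Rightarrow> real" where "\<psi> z = (if z = x then 1/2 else 0) - (if z = v then 1/2 else 0)" for z
  have deg: "(\<Sum>u\<in>V. adj z u) = real d" if "z \<in> V" for z
    using sum_nb[OF that, of "\<lambda>_. 1"] reg[OF that] by simp
  have lap: "laplacian V adj \<psi> z = real d * \<psi> z - (adj z x - adj z v) / 2" if "z \<in> V" for z
  proof -
    have "laplacian V adj \<psi> z = (\<Sum>u\<in>V. adj z u * \<psi> z)
        - (\<Sum>u\<in>V. (if u = x then adj z x / 2 else 0) - (if u = v then adj z v / 2 else 0))"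
      unfolding laplacian_def sum_subtractf[symmetric]
      by (rule sum.cong) (auto simp: \<psi>_def algebra_simps)
    then show ?thesis
      using V finite by (simp add: sum_distrib_right[symmetric] deg[OF that] sum_subtractf diff_divide_distrib)
  qed
  have "energy V adj (\<lambda>z. \<psi> z + 1/2) (\<lambda>z. \<psi> z + 1/2)
      = (\<Sum>z\<in>V. laplacian V adj \<psi> z * \<psi> z) + (\<Sum>z\<in>V. laplacian V adj \<psi> z) / 2"
    by (simp add: energy_def laplacian_def distrib_left sum.distrib sum_divide_distrib)
  also have "(\<Sum>z\<in>V. laplacian V adj \<psi> z) = 0"
    by (intro sum_laplacian c_sym)
  also have "(\<Sum>z\<in>V. laplacian V adj \<psi> z * \<psi> z)
      = (\<Sum>z\<in>V. (if z = x then laplacian V adj \<psi> x / 2 else 0)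
          - (if z = v then laplacian V adj \<psi> v / 2 else 0))"
    by (rule sum.cong) (auto simp: \<psi>_def)
  also have "\<dots> = laplacian V adj \<psi> x / 2 - laplacian V adj \<psi> v / 2"
    using V finite by (simp add: sum_subtractf)
  also have "\<dots> = (real d + 1) / 2"
    using V vx loopless[of v] loopless[of x]
    by (auto simp: lap \<psi>_def conductance_def insert_commute field_simps)
  finally have en: "energy V adj (\<lambda>z. \<psi> z + 1/2) (\<lambda>z. \<psi> z + 1/2) = (real d + 1) / 2"
    by simp
  have "\<psi> v + 1/2 = 0" "\<psi> x + 1/2 = 1"
    using V by (auto simp: \<psi>_def)
  from g_diag_ge[OF V(2), of "\<lambda>z. \<psi> z + 1/2", OF this] show ?thesis
    by (simp add: edge_prob_same[OF vx] en)
qed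

section \<open>Sums of mean degrees and of their squares\<close>

lemma edge_prob_le_1: "edge_prob e f \<le> 1"
  unfolding edge_prob_def using card_trees_pos finite_trees
  by (simp add: card_mono)

lemma sum_edge_prob:
  "(\<Sum>e\<in>E. edge_prob e e * h e) = (\<Sum>T\<in>sp_trees. \<Sum>e\<in>T. h e) / real (card sp_trees)"
proof -
  have "(\<Sum>T\<in>sp_trees. \<Sum>e\<in>T. h e) = (\<Sum>T\<in>sp_trees. \<Sum>e | e \<in> E \<and> e \<in> T. h e)"
    using tree_subset by (intro sum.cong) auto
  also have "\<dots> = (\<Sum>e\<in>E. \<Sum>T | T \<in> sp_trees \<and> e \<in> T. h e)"
    by (rule sum.swap_restrict[OF finite_trees finite_E])
  finally show ?thesis
    by (simp add: edge_prob_def sum_divide_distrib)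
qed

lemma sum_vertices_edges:
  "(\<Sum>v\<in>V. \<Sum>e | e \<in> E \<and> v \<in> e. h v e) = (\<Sum>e\<in>E. \<Sum>v\<in>e. h v e)"
proof -
  have "{v. v \<in> V \<and> v \<in> e} = e" if "e \<in> E" for e
    using that E_Pow by auto
  then show ?thesis
    by (simp add: sum.swap_restrict[OF finite_V finite_E])
qed

text \<open>Foster's theorem, as the expected number of edges of the random tree.\<close>

lemma foster: "(\<Sum>e\<in>E. edge_prob e e) = real (card V) - 1"
proof -
  have "(\<Sum>T\<in>sp_trees. \<Sum>e\<in>T. 1 :: real) = real (card sp_trees) * (real (card V) - 1)"
    using card_tree V_nonempty finite_V by (simp add: of_nat_diff Suc_leI card_gt_0_iff)
  then show ?thesis
    using sum_edge_prob[of "\<lambda>_. 1"] card_trees_pos by simp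
qed

lemma mean_degree_alt: "mean_degree v = (\<Sum>e | e \<in> E \<and> v \<in> e. edge_prob e e)"
  unfolding mean_degree_def by (rule sum.reindex_bij_betw[OF incident_bij])

text \<open>Every spanning tree assigns to each of its edges one of its endpoints, injectively.
  Charging one endpoint with \<open>X\<close> and bounding the other one by \<open>D\<close> saves a factor of two
  over the trivial estimate \<open>X v \<le> D\<close>.\<close>

lemma excess_bound:
  fixes x :: "'a set \<Rightarrow> real"
  assumes x: "\<And>e. e \<in> E \<Longrightarrow> 0 \<le> x e" "\<And>e. e \<in> E \<Longrightarrow> x e \<le> edge_prob e e"
    and D: "\<And>v. v \<in> V \<Longrightarrow> (\<Sum>e | e \<in> E \<and> v \<in> e. x e) \<le> D"
  shows "(\<Sum>v\<in>V. (\<Sum>e | e \<in> E \<and> v \<in> e. x e)\<^sup>2)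
    \<le> (\<Sum>v\<in>V. \<Sum>e | e \<in> E \<and> v \<in> e. x e) + D * (\<Sum>e\<in>E. x e)"
proof -
  define X where "X v = (\<Sum>e | e \<in> E \<and> v \<in> e. x e)" for v
  \<comment> \<open>The share of the edge probability that \<open>x\<close> retains. For an edge of
    probability 0 also \<open>x e = 0\<close>, in agreement with the default value of
    division.\<close>
  define \<theta> where "\<theta> e = x e / edge_prob e e" for e
  let ?N = "real (card sp_trees)"
  have N: "0 < ?N"
    using card_trees_pos by simp
  have X: "0 \<le> X v" "v \<in> V \<Longrightarrow> X v \<le> D" for v
    using x D by (auto simp: X_def intro!: sum_nonneg)
  have \<theta>: "0 \<le> \<theta> e" "\<theta> e \<le> 1" "edge_prob e e * \<theta> e = x e" if "e \<in> E" for e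
    using x[OF that] by (auto simp: \<theta>_def divide_le_eq_1)
  have tree: "(\<Sum>e\<in>T. \<theta> e * (\<Sum>v\<in>e. X v)) \<le> (\<Sum>v\<in>V. X v) + D * (\<Sum>e\<in>T. \<theta> e)"
    if T: "T \<in> sp_trees" for T
  proof -
    obtain r where r: "r \<in> V"
      using V_nonempty by blast
    obtain f where f: "bij_betw f (V - {r}) T" "\<And>z. z \<in> V - {r} \<Longrightarrow> z \<in> f z"
      using tree_edge_bij[OF T r] by metis
    have step: "\<theta> (f z) * (\<Sum>v\<in>f z. X v) \<le> X z + D * \<theta> (f z)" if z: "z \<in> V - {r}" for z
    proof -
      have fz: "f z \<in> E"
        using f(1) z tree_subset[OF T] by (auto simp: bij_betw_def)
      then obtain a b where "f z = {a, b}" "a \<noteq> b" "a \<in> V" "b \<in> V"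
        using edgeE by metis
      then obtain u where u: "f z = {z, u}" "u \<noteq> z" "u \<in> V"
        using f(2)[OF z] by auto
      have "\<theta> (f z) * (X z + X u) \<le> 1 * X z + \<theta> (f z) * D"
        unfolding distrib_left using \<theta>[OF fz] X u by (intro add_mono mult_mono) auto
      then show ?thesis
        using u by (simp add: mult.commute)
    qed
    have "(\<Sum>e\<in>T. \<theta> e * (\<Sum>v\<in>e. X v)) = (\<Sum>z\<in>V - {r}. \<theta> (f z) * (\<Sum>v\<in>f z. X v))"
      by (rule sum.reindex_bij_betw[OF f(1), symmetric])
    also have "\<dots> \<le> (\<Sum>z\<in>V - {r}. X z + D * \<theta> (f z))"
      by (intro sum_mono step)
    also have "\<dots> = (\<Sum>z\<in>V - {r}. X z) + D * (\<Sum>z\<in>V - {r}. \<theta> (f z))"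
      by (simp add: sum.distrib sum_distrib_left)
    also have "(\<Sum>z\<in>V - {r}. \<theta> (f z)) = (\<Sum>e\<in>T. \<theta> e)"
      by (rule sum.reindex_bij_betw[OF f(1)])
    also have "(\<Sum>z\<in>V - {r}. X z) \<le> (\<Sum>v\<in>V. X v)"
      using X finite_V by (intro sum_mono2) auto
    finally show ?thesis
      by simp
  qed
  have "(\<Sum>v\<in>V. (X v)\<^sup>2) = (\<Sum>v\<in>V. \<Sum>e | e \<in> E \<and> v \<in> e. x e * X v)"
    by (simp add: power2_eq_square sum_distrib_right[symmetric] X_def)
  also have "\<dots> = (\<Sum>e\<in>E. edge_prob e e * (\<theta> e * (\<Sum>v\<in>e. X v)))"
    unfolding sum_vertices_edges
    by (rule sum.cong) (simp_all add: \<theta>(3)[symmetric] sum_distrib_left[symmetric] mult.assoc)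
  also have "\<dots> \<le> (\<Sum>T\<in>sp_trees. (\<Sum>v\<in>V. X v) + D * (\<Sum>e\<in>T. \<theta> e)) / ?N"
    unfolding sum_edge_prob by (intro divide_right_mono sum_mono tree) auto
  also have "\<dots> = (\<Sum>v\<in>V. X v) + D * (\<Sum>e\<in>E. edge_prob e e * \<theta> e)"
    using N by (simp add: sum_edge_prob sum.distrib add_divide_distrib flip: sum_distrib_left)
  also have "(\<Sum>e\<in>E. edge_prob e e * \<theta> e) = (\<Sum>e\<in>E. x e)"
    by (rule sum.cong) (simp_all add: \<theta>)
  finally show ?thesis
    unfolding X_def .
qed

lemma sum_mean_degree: "(\<Sum>v\<in>V. mean_degree v) = 2 * (real (card V) - 1)"
proof -
  have "card e = 2" if "e \<in> E" for e
    using that edgeE card_2_iff by metis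
  then show ?thesis
    by (simp add: mean_degree_alt sum_vertices_edges sum_distrib_left[symmetric] foster mult.commute
        flip: sum_distrib_left)
qed

text \<open>Expand the square of base \<open>?a\<close> plus excess \<open>X v\<close>. For large
  \<open>d\<close> the base contributes nearly \<open>4 * n\<close>, the squared excess at most
  about \<open>n\<close>, and the cross term is of lower order.\<close>

lemma sum_mean_degree_sq:
  assumes reg: "\<And>v. v \<in> V \<Longrightarrow> card (nb v) = d" and d: "0 < d"
  shows "(\<Sum>v\<in>V. (mean_degree v)\<^sup>2) \<le> 5 * real (card V)"
proof -
  define s where "s = 2 / (real d + 1)"
  define x where "x e = edge_prob e e - s" for e
  define X where "X v = (\<Sum>e | e \<in> E \<and> v \<in> e. x e)" for v
  define Q where "Q = (\<Sum>e\<in>E. x e)"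
  let ?n = "real (card V)" and ?a = "real d * s"
  have card2: "card e = 2" if "e \<in> E" for e
    using that edgeE card_2_iff by metis
  have deg: "card {e \<in> E. v \<in> e} = d" if "v \<in> V" for v
    using reg[OF that] bij_betw_same_card[OF incident_bij] by metis
  have x0: "0 \<le> x e" if "e \<in> E" for e
    using edge_prob_ge[OF reg] edgeE[OF that] that unfolding x_def s_def
    by (metis diff_ge_0_iff_ge)
  have X: "X v = mean_degree v - ?a" if "v \<in> V" for v
    using deg[OF that] by (simp add: X_def x_def mean_degree_alt sum_subtractf)
  have sumX: "(\<Sum>v\<in>V. X v) = 2 * Q"
    using card2 by (simp add: X_def Q_def sum_vertices_edges sum_distrib_left)
  moreover have "(\<Sum>v\<in>V. X v) = 2 * (?n - 1) - ?n * ?a"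
    using X sum_mean_degree by (simp add: sum_subtractf)
  ultimately have "Q = ?n - 1 - ?n * ?a / 2"
    by simp
  also have "?n * ?a / 2 = ?n - ?n / (real d + 1)"
    by (simp add: s_def field_simps)
  finally have Q: "Q \<le> ?n / (real d + 1)"
    by simp
  have mean_le: "mean_degree v \<le> real d" if "v \<in> V" for v
  proof -
    have "mean_degree v \<le> (\<Sum>x\<in>nb v. 1)"
      unfolding mean_degree_def by (intro sum_mono edge_prob_le_1)
    then show ?thesis
      using reg[OF that] by simp
  qed
  \<comment> \<open>A mean degree is at most \<open>d\<close>, so no excess at a vertex exceeds
    \<open>real d - ?a\<close>.\<close>
  have "(\<Sum>v\<in>V. (X v)\<^sup>2) \<le> (\<Sum>v\<in>V. X v) + (real d - ?a) * (\<Sum>e\<in>E. x e)"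
    unfolding X_def
  proof (rule excess_bound)
    show "x e \<le> edge_prob e e" for e
      by (simp add: x_def s_def)
    show "(\<Sum>e | e \<in> E \<and> v \<in> e. x e) \<le> real d - ?a" if "v \<in> V" for v
      using X[OF that] mean_le[OF that] by (simp add: X_def)
  qed (rule x0)
  then have X2: "(\<Sum>v\<in>V. (X v)\<^sup>2) \<le> (2 + real d - ?a) * Q"
    unfolding sumX Q_def[symmetric] by (simp add: algebra_simps)
  have "(\<Sum>v\<in>V. (mean_degree v)\<^sup>2) = (\<Sum>v\<in>V. (X v)\<^sup>2 + 2 * ?a * X v + ?a\<^sup>2)"
    by (rule sum.cong) (simp_all add: X power2_eq_square algebra_simps)
  also have "\<dots> = (\<Sum>v\<in>V. (X v)\<^sup>2) + 4 * ?a * Q + ?n * ?a\<^sup>2"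
    by (simp add: sum.distrib sum_distrib_left[symmetric] sumX)
  also have "\<dots> \<le> (2 + real d + 3 * ?a) * Q + ?n * ?a\<^sup>2"
    using X2 by (simp add: algebra_simps)
  also have "\<dots> \<le> (2 + real d + 3 * ?a) * (?n / (real d + 1)) + ?n * ?a\<^sup>2"
    using Q by (intro add_right_mono mult_left_mono) (simp_all add: s_def)
  also have "\<dots> = ?n * ((2 + real d + 3 * ?a) / (real d + 1) + ?a\<^sup>2)"
    by (simp add: algebra_simps add_divide_distrib)
  also have "(2 + real d + 3 * ?a) / (real d + 1) + ?a\<^sup>2
      = (5 * (real d)\<^sup>2 + 9 * real d + 2) / (real d + 1)\<^sup>2"
  proof -
    have "t \<noteq> 0 \<Longrightarrow> (2 + r + 3 * (r * (2 / t))) / t + (r * (2 / t))\<^sup>2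
        = ((2 + r) * t + 6 * r + 4 * r\<^sup>2) / t\<^sup>2" for r t :: real
      by (simp add: field_simps power2_eq_square)
    from this[of "real d + 1" "real d"] show ?thesis
      unfolding s_def by (simp add: algebra_simps power2_eq_square)
  qed
  also have "?n * ((5 * (real d)\<^sup>2 + 9 * real d + 2) / (real d + 1)\<^sup>2) \<le> ?n * 5"
    by (intro mult_left_mono, subst pos_divide_le_eq) (auto simp: power2_eq_square algebra_simps intro: add_pos_nonneg)
  finally show ?thesis
    by simp
qed

lemma nb_nonempty:
  assumes "2 \<le> card V" "v \<in> V"
  shows "nb v \<noteq> {}"
proof -
  obtain x where x: "x \<in> V" "x \<noteq> v"
    using assms by (metis card_le_Suc0_iff_eq finite_V not_less_eq_eq numeral_2_eq_2)
  obtain T where "T \<in> sp_trees"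
    using trees_nonempty by blast
  then show ?thesis
    using tree_branch[of T v x] assms x tree_subset by (fastforce simp: nb_def)
qed

lemma second_moment_le_6:
  assumes reg: "regular_graph V E"
  shows "ust_degree_second_moment V E \<le> 6"
proof (cases "2 \<le> card V")
  case True
  obtain d where d: "\<And>v. v \<in> V \<Longrightarrow> card (nb v) = d"
    using reg by (auto simp: regular_graph_def degree_card_nb)
  have "0 < d"
    using nb_nonempty[OF True] V_nonempty d finite_nb by (metis card_gt_0_iff ex_in_conv)
  have "second_moment v \<le> mean_degree v + (mean_degree v)\<^sup>2 - 1" if "v \<in> V" for v
    using second_moment_eq[OF that d[OF that] \<open>0 < d\<close>] by (simp add: sum_nonneg)
  then have "(\<Sum>v\<in>V. second_moment v) \<le> (\<Sum>v\<in>V. mean_degree v + (mean_degree v)\<^sup>2 - 1)"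
    by (rule sum_mono)
  also have "\<dots> \<le> 6 * real (card V)"
    using sum_mean_degree_sq[OF d \<open>0 < d\<close>] by (simp add: sum.distrib sum_subtractf sum_mean_degree)
  finally show ?thesis
    using True by (simp add: ust_degree_second_moment_eq divide_le_eq)
next
  \<comment> \<open>A single vertex has degree 0, outside the range of
    \<open>second_moment_eq\<close>.\<close>
  case False
  then have "x = y" if "x \<in> V" "y \<in> V" for x y
    using that finite_V by (metis card_le_Suc0_iff_eq not_less_eq_eq numeral_2_eq_2)
  then have "E = {}"
    using edgeE by (metis ex_in_conv)
  then have "degree T v = 0" if "T \<in> sp_trees" for T v
    using tree_subset[OF that] by (simp add: degree_def)
  then have "second_moment v = 0" for v
    by (simp add: second_moment_def)
  then show ?thesis
    by (simp add: ust_degree_second_moment_eq)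
qed

end

subsection \<open>Sharpness\<close>

text \<open>Compare with the complete graph on \<open>B\<close>, whose Laplacian is \<open>card B\<close> on mean-zero functions;
  the missing edges cost at most \<open>2 * r\<close>.\<close>

lemma spectral_gap:
  fixes c :: "'a \<Rightarrow> 'a \<Rightarrow> real"
  assumes sym: "\<And>z u. c z u = c u z" and c1: "\<And>z u. c z u \<le> 1"
    and deg: "\<And>z. z \<in> B \<Longrightarrow> real (card B) - r \<le> (\<Sum>u\<in>B. c z u)"
    and mean: "(\<Sum>z\<in>B. \<psi> z) = 0"
  shows "(real (card B) - 2 * r) * (\<Sum>z\<in>B. (\<psi> z)\<^sup>2)
    \<le> (\<Sum>z\<in>B. \<Sum>u\<in>B. c z u * (\<psi> z - \<psi> u)\<^sup>2) / 2"
proof -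
  let ?n = "real (card B)" and ?A = "\<Sum>z\<in>B. (\<psi> z)\<^sup>2"
  have full: "(\<Sum>z\<in>B. \<Sum>u\<in>B. (\<psi> z - \<psi> u)\<^sup>2) = 2 * ?n * ?A"
  proof -
    have "(\<Sum>z\<in>B. \<Sum>u\<in>B. (\<psi> z - \<psi> u)\<^sup>2)
        = (\<Sum>z\<in>B. \<Sum>u\<in>B. (\<psi> z)\<^sup>2 + (\<psi> u)\<^sup>2 - 2 * (\<psi> z * \<psi> u))"
      by (simp add: power2_diff mult.assoc)
    also have "\<dots> = 2 * ?n * ?A - 2 * ((\<Sum>z\<in>B. \<psi> z) * (\<Sum>u\<in>B. \<psi> u))"
      by (simp add: sum.distrib sum_subtractf sum_product sum_distrib_left[symmetric])
    finally show ?thesis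
      by (simp add: mean)
  qed
  have "(\<Sum>z\<in>B. \<Sum>u\<in>B. (1 - c z u) * (\<psi> z - \<psi> u)\<^sup>2)
      \<le> (\<Sum>z\<in>B. \<Sum>u\<in>B. (1 - c z u) * (2 * (\<psi> z)\<^sup>2 + 2 * (\<psi> u)\<^sup>2))"
  proof (intro sum_mono mult_left_mono)
    show "(\<psi> z - \<psi> u)\<^sup>2 \<le> 2 * (\<psi> z)\<^sup>2 + 2 * (\<psi> u)\<^sup>2" for z u
      using zero_le_power2[of "\<psi> z + \<psi> u"] by (simp add: power2_diff power2_sum)
  qed (simp add: c1)
  also have "\<dots> = 2 * (\<Sum>z\<in>B. \<Sum>u\<in>B. (1 - c z u) * (\<psi> z)\<^sup>2)
      + 2 * (\<Sum>z\<in>B. \<Sum>u\<in>B. (1 - c z u) * (\<psi> u)\<^sup>2)"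
    by (simp add: distrib_left sum.distrib sum_distrib_left mult_ac)
  also have "(\<Sum>z\<in>B. \<Sum>u\<in>B. (1 - c z u) * (\<psi> u)\<^sup>2) = (\<Sum>z\<in>B. \<Sum>u\<in>B. (1 - c z u) * (\<psi> z)\<^sup>2)"
    by (subst sum.swap) (simp add: sym)
  also have "(\<Sum>z\<in>B. \<Sum>u\<in>B. (1 - c z u) * (\<psi> z)\<^sup>2) \<le> (\<Sum>z\<in>B. r * (\<psi> z)\<^sup>2)"
  proof (rule sum_mono)
    fix z assume "z \<in> B"
    then have "(\<Sum>u\<in>B. 1 - c z u) \<le> r"
      using deg[of z] by (simp add: sum_subtractf)
    then show "(\<Sum>u\<in>B. (1 - c z u) * (\<psi> z)\<^sup>2) \<le> r * (\<psi> z)\<^sup>2"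
      by (simp add: sum_distrib_right[symmetric] mult_right_mono)
  qed
  finally have "(\<Sum>z\<in>B. \<Sum>u\<in>B. (1 - c z u) * (\<psi> z - \<psi> u)\<^sup>2) \<le> 4 * r * ?A"
    by (simp add: sum_distrib_left[symmetric])
  moreover have "(\<Sum>z\<in>B. \<Sum>u\<in>B. (1 - c z u) * (\<psi> z - \<psi> u)\<^sup>2)
      = (\<Sum>z\<in>B. \<Sum>u\<in>B. (\<psi> z - \<psi> u)\<^sup>2) - (\<Sum>z\<in>B. \<Sum>u\<in>B. c z u * (\<psi> z - \<psi> u)\<^sup>2)"
    by (simp add: left_diff_distrib sum_subtractf)
  ultimately show ?thesis
    unfolding full by (simp add: left_diff_distrib)
qed

text \<open>The mean, here 0, minimises the sum of squared deviations.\<close>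

lemma sum_square_centered:
  fixes \<phi> :: "'b \<Rightarrow> real"
  assumes "(\<Sum>x\<in>S. \<phi> x) = 0"
  shows "(\<Sum>x\<in>S. (\<phi> x)\<^sup>2) \<le> (\<Sum>x\<in>S. (\<phi> x - \<mu>)\<^sup>2)"
proof -
  have "(\<Sum>x\<in>S. (\<phi> x - \<mu>)\<^sup>2) = (\<Sum>x\<in>S. (\<phi> x)\<^sup>2) + real (card S) * \<mu>\<^sup>2 - 2 * (\<Sum>x\<in>S. \<phi> x) * \<mu>"
    by (simp add: power2_diff sum.distrib sum_subtractf sum_distrib_left sum_distrib_right)
  then show ?thesis
    using assms by simp
qed

section \<open>Lower bounds for second moments from a spectral gap\<close>

context fin_conn_graph
begin

text \<open>The gap needs mean zero on the whole block, but \<open>\<phi>\<close> has it only on the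
  neighbours of \<open>v\<close>. Subtracting the block mean keeps all differences and cannot
  decrease the sum of squares over those neighbours; pairs outside the block only add
  energy.\<close>

lemma energy_ge_block:
  assumes B: "B \<subseteq> V" "nb v \<subseteq> B" and deg: "\<And>z. z \<in> B \<Longrightarrow> real (card B) - r \<le> real (card (nb z \<inter> B))"
    and pos: "0 \<le> real (card B) - 2 * r" and phi: "(\<Sum>x\<in>nb v. \<phi> x) = 0"
  shows "(real (card B) - 2 * r) * (\<Sum>x\<in>nb v. (\<phi> x)\<^sup>2) \<le> energy V adj \<phi> \<phi>"
proof (cases "B = {}")
  case True
  have "0 \<le> energy V adj \<phi> \<phi>"
    by (rule energy_nonneg) (auto simp: conductance_def insert_commute)
  then show ?thesis
    using True B by simp
next
  case False
  have finB: "finite B"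
    using B finite_V finite_subset by blast
  define \<mu> where "\<mu> = (\<Sum>z\<in>B. \<phi> z) / real (card B)"
  have "(\<Sum>z\<in>B. \<phi> z - \<mu>) = 0"
    using finB False by (simp add: sum_subtractf \<mu>_def)
  moreover have "real (card B) - r \<le> (\<Sum>u\<in>B. adj z u)" if "z \<in> B" for z
  proof -
    have "(\<Sum>u\<in>B. adj z u) = real (card (nb z \<inter> B))"
      using finB by (simp add: conductance_def nb_def sum.If_cases Int_commute Collect_conj_eq)
    then show ?thesis
      using deg[OF that] by simp
  qed
  ultimately have gap: "(real (card B) - 2 * r) * (\<Sum>z\<in>B. (\<phi> z - \<mu>)\<^sup>2)
      \<le> (\<Sum>z\<in>B. \<Sum>u\<in>B. adj z u * ((\<phi> z - \<mu>) - (\<phi> u - \<mu>))\<^sup>2) / 2"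
    by (intro spectral_gap) (auto simp: conductance_def insert_commute)
  have "(\<Sum>x\<in>nb v. (\<phi> x)\<^sup>2) \<le> (\<Sum>z\<in>B. (\<phi> z - \<mu>)\<^sup>2)"
    using sum_square_centered[OF phi, of \<mu>] sum_mono2[OF finB B(2), of "\<lambda>x. (\<phi> x - \<mu>)\<^sup>2"] by simp
  then have "(real (card B) - 2 * r) * (\<Sum>x\<in>nb v. (\<phi> x)\<^sup>2)
      \<le> (real (card B) - 2 * r) * (\<Sum>z\<in>B. (\<phi> z - \<mu>)\<^sup>2)"
    using pos by (rule mult_left_mono)
  also note gap
  also have "(\<Sum>z\<in>B. \<Sum>u\<in>B. adj z u * ((\<phi> z - \<mu>) - (\<phi> u - \<mu>))\<^sup>2) / 2 \<le> energy V adj \<phi> \<phi>"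
  proof -
    have "(\<Sum>z\<in>B. \<Sum>u\<in>B. adj z u * (\<phi> z - \<phi> u)\<^sup>2) \<le> (\<Sum>z\<in>V. \<Sum>u\<in>V. adj z u * (\<phi> z - \<phi> u)\<^sup>2)"
      using B finite_V
      by (intro order_trans[OF sum_mono2[of V B] sum_mono] sum_mono2) (auto intro!: sum_nonneg simp: conductance_def)
    moreover have "energy V adj \<phi> \<phi> = (\<Sum>z\<in>V. \<Sum>u\<in>V. adj z u * (\<phi> z - \<phi> u)\<^sup>2) / 2"
      by (subst energy_alt) (auto simp: conductance_def insert_commute power2_eq_square mult.assoc)
    ultimately show ?thesis
      by simp
  qed
  finally show ?thesis .
qed

text \<open>The gap controls the variance term of \<open>second_moment_eq\<close>: a centred column
  of the Green function extends to a function whose energy is just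
  \<open>g y y - 1 / d\<close>.\<close>

lemma second_moment_ge:
  assumes v: "v \<in> V" and d: "card (nb v) = d" "0 < d" and l: "0 < l"
    and gap: "\<And>\<phi>. (\<Sum>x\<in>nb v. \<phi> x) = 0 \<Longrightarrow> l * (\<Sum>x\<in>nb v. (\<phi> x)\<^sup>2) \<le> energy V adj \<phi> \<phi>"
  shows "mean_degree v + (mean_degree v)\<^sup>2 - 1 - (mean_degree v - 1) / l \<le> second_moment v"
proof -
  let ?g = "ugreen v"
  interpret green_function V adj v "ugreen v"
    by (rule ugreen[OF v])
  \<comment> \<open>This is the potential of unit charges at all neighbours of the root, so pairing
    with it sums over the neighbours.\<close>
  define J :: "'a \<Rightarrow> real" where "J z = of_bool (z \<noteq> v)" for z
  have energy_J: "energy V adj J \<phi> = (\<Sum>x\<in>nb v. \<phi> x)" if "\<phi> v = 0" for \<phi>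
  proof -
    have lap_J: "laplacian V adj J z * \<phi> z = adj v z * \<phi> z" if "z \<in> V" for z
    proof (cases "z = v")
      case False
      then have "laplacian V adj J z = (\<Sum>u\<in>V. if u = v then adj z v else 0)"
        unfolding laplacian_def by (intro sum.cong) (auto simp: J_def)
      then show ?thesis
        using finite v c_sym[of z v] by simp
    qed (simp add: \<open>\<phi> v = 0\<close>)
    show ?thesis
      unfolding energy_def sum_nb[OF v] by (rule sum.cong[OF refl lap_J])
  qed
  have col: "(\<Sum>x\<in>nb v. (?g x y - 1 / real d)\<^sup>2) \<le> (?g y y - 1 / real d) / l" if y: "y \<in> nb v" for y
  proof -
    define h where "h z = ?g y z - 1 / real d * J z" for z
    have yV: "y \<in> V - {v}"
      using y nb_subset by blast
    have hv: "h v = 0"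
      by (simp add: h_def J_def g_root)
    have h: "h x = ?g x y - 1 / real d" if "x \<in> nb v" for x
      using that nb_subset[of v] by (auto simp: h_def J_def g_sym[of y x])
    have mean: "(\<Sum>x\<in>nb v. h x) = 0"
      using sum_ugreen_nb[OF v y] d by (simp add: h sum_subtractf)
    have "energy V adj h h = energy V adj (?g y) h - 1 / real d * energy V adj J h"
      unfolding h_def[abs_def] by (simp only: energy_diff_left energy_scale_left)
    also have "\<dots> = ?g y y - 1 / real d"
      using energy_g[OF yV, of h, OF hv] energy_J[of h, OF hv] mean h[OF y] by simp
    finally have "l * (\<Sum>x\<in>nb v. (h x)\<^sup>2) \<le> ?g y y - 1 / real d"
      using gap[OF mean] by simp
    then show ?thesis
      using l by (simp add: h field_simps)
  qed
  have m: "mean_degree v = (\<Sum>x\<in>nb v. ?g x x)"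
    unfolding mean_degree_def by (rule sum.cong) (auto simp: nb_def edge_prob_same)
  have "(\<Sum>y\<in>nb v. \<Sum>x\<in>nb v. (?g x y - 1 / real d)\<^sup>2) \<le> (\<Sum>y\<in>nb v. (?g y y - 1 / real d) / l)"
    by (intro sum_mono col)
  also have "\<dots> = (mean_degree v - 1) / l"
    using d by (simp add: m sum_subtractf sum_divide_distrib[symmetric])
  finally show ?thesis
    using second_moment_eq[OF v d] by simp
qed

text \<open>For \<open>1 \<le> l\<close> the bound of \<open>second_moment_ge\<close> increases with
  the mean degree, so the lower bound from \<open>edge_prob_ge\<close> may be inserted.\<close>

lemma second_moment_regular_ge:
  assumes v: "v \<in> V" and reg: "\<And>v. v \<in> V \<Longrightarrow> card (nb v) = d" and d: "0 < d" and l: "1 \<le> l"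
    and gap: "\<And>\<phi>. (\<Sum>x\<in>nb v. \<phi> x) = 0 \<Longrightarrow> l * (\<Sum>x\<in>nb v. (\<phi> x)\<^sup>2) \<le> energy V adj \<phi> \<phi>"
  defines "a \<equiv> 2 * real d / (real d + 1)"
  shows "a + a\<^sup>2 - 1 - (a - 1) / l \<le> second_moment v"
proof -
  let ?m = "mean_degree v"
  have "(\<Sum>x\<in>nb v. 2 / (real d + 1)) \<le> ?m"
    unfolding mean_degree_def by (intro sum_mono edge_prob_ge reg) (auto simp: nb_def)
  then have am: "a \<le> ?m"
    using reg[OF v] by (simp add: a_def mult.commute)
  have "0 \<le> a"
    by (simp add: a_def)
  then have "a\<^sup>2 \<le> ?m\<^sup>2"
    using am by (intro power_mono)
  moreover have "a * (1 - 1 / l) \<le> ?m * (1 - 1 / l)"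
    using am l by (intro mult_right_mono) auto
  ultimately have "a + a\<^sup>2 - 1 - (a - 1) / l \<le> ?m + ?m\<^sup>2 - 1 - (?m - 1) / l"
    by (simp add: right_diff_distrib diff_divide_distrib)
  also have "\<dots> \<le> second_moment v"
    using l by (intro second_moment_ge[OF v reg[OF v] d _ gap]) auto
  finally show ?thesis .
qed

end

text \<open>A hub joined by bridges to one vertex of each of \<open>d\<close> blocks. A block is the complete graph on
  \<open>N = d + 2\<close> vertices minus the path 1-0-2 and the matching 3-4, 5-6, \<dots>: vertex 0, the one joined
  to the hub, has degree \<open>d - 1\<close> in its block, and the others have degree \<open>d\<close>. Vertex \<open>j\<close> of
  block \<open>i\<close> is the number \<open>i * N + j\<close>, and the hub is \<open>d * N\<close>.\<close>

definition non_nb :: "nat \<Rightarrow> nat set" where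
  "non_nb j = (if j = 0 then {1, 2} else if j \<le> 2 then {0} else if odd j then {j + 1} else {j - 1})"

lemma non_nb_sym: "l \<in> non_nb j \<longleftrightarrow> j \<in> non_nb l"
proof -
  have "j \<in> non_nb l" if "l \<in> non_nb j" for j l
    using that by (auto simp: non_nb_def split: if_splits)
  then show ?thesis
    by blast
qed

lemma non_nb_irrefl: "j \<notin> non_nb j"
  by (auto simp: non_nb_def)

section \<open>The hub graph: regularity and connectedness\<close>

locale hub_graph =
  fixes d N :: nat
  assumes d: "odd d" "5 \<le> d" and N: "N = d + 2"
begin

definition V :: "nat set" where
  "V = {..d * N}"

text \<open>The hub has quotient \<open>d\<close>, shared by no other number in \<open>V\<close>, so
  the block clause never applies to it there.\<close>

definition linked :: "nat \<Rightarrow> nat \<Rightarrow> bool" where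
  "linked x y \<longleftrightarrow> x \<noteq> y \<and> (x div N = y div N \<and> y mod N \<notin> non_nb (x mod N)
     \<or> x = d * N \<and> y mod N = 0 \<or> y = d * N \<and> x mod N = 0)"

definition E :: "nat set set" where
  "E = {{x, y} | x y. x \<in> V \<and> y \<in> V \<and> linked x y}"

lemma linked_sym: "linked x y \<longleftrightarrow> linked y x"
  using non_nb_sym by (auto simp: linked_def)

lemma edge_iff: "{x, y} \<in> E \<longleftrightarrow> x \<in> V \<and> y \<in> V \<and> linked x y"
  using linked_sym by (auto simp: E_def doubleton_eq_iff)

lemma N_pos: "0 < N"
  by (simp add: N)

text \<open>As \<open>N\<close> is odd, the matching ends with the pair \<open>N - 2\<close>,
  \<open>N - 1\<close> and stays inside the block.\<close>

lemma non_nb_bound: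
  assumes "j < N"
  shows "non_nb j \<subseteq> {..<N}"
proof -
  have "odd N"
    using d N by simp
  then have "j + 1 < N" if "odd j" 
    using that assms by presburger
  then show ?thesis
    using assms d N by (auto simp: non_nb_def)
qed

lemma in_V: "i < d \<Longrightarrow> j < N \<Longrightarrow> i * N + j \<in> V"
proof -
  assume ij: "i < d" "j < N"
  then have "i * N + j < Suc i * N"
    by simp
  also have "\<dots> \<le> d * N"
    using ij by (intro mult_le_mono1) simp
  finally show ?thesis
    by (simp add: V_def)
qed

lemma VE:
  assumes "x \<in> V"
  obtains "x = d * N" | i j where "i < d" "j < N" "x = i * N + j"
proof (cases "x = d * N")
  case False
  then have "x < d * N"
    using assms by (simp add: V_def)
  then have "x div N < d"
    by (simp add: less_mult_imp_div_less)
  moreover have "x = x div N * N + x mod N"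
    by simp
  ultimately show ?thesis
    using that(2) N_pos mod_less_divisor by blast
qed

lemma div_block [simp]: "j < N \<Longrightarrow> (i * N + j) div N = i"
  by simp

lemma mod_block [simp]: "j < N \<Longrightarrow> (i * N + j) mod N = j"
  by simp

lemma not_hub: "i < d \<Longrightarrow> j < N \<Longrightarrow> i * N + j \<noteq> d * N"
  by (metis div_block div_mult_self_is_m N_pos less_irrefl)

lemma neighbours_block:
  assumes i: "i < d" and j: "j < N"
  shows "{y. {i * N + j, y} \<in> E}
    = (\<lambda>l. i * N + l) ` ({..<N} - insert j (non_nb j)) \<union> (if j = 0 then {d * N} else {})"
    (is "?L = ?R")
proof (intro equalityI subsetI)
  fix y assume "y \<in> ?L"
  then have y: "y \<in> V" "linked (i * N + j) y"
    by (simp_all add: edge_iff)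
  from y(1) show "y \<in> ?R"
  proof (cases rule: VE)
    case 1
    then show ?thesis
      using y(2) i j N_pos by (auto simp: linked_def)
  next
    case (2 a l)
    then show ?thesis
      using y(2) i j not_hub by (auto simp: linked_def)
  qed
next
  fix y assume "y \<in> ?R"
  then show "y \<in> ?L"
    using i j in_V[OF i j] in_V[OF i] not_hub[OF i j]
    by (auto simp: edge_iff linked_def V_def split: if_splits)
qed

lemma neighbours_hub: "{y. {d * N, y} \<in> E} = (\<lambda>i. i * N) ` {..<d}" (is "?L = ?R")
proof (intro equalityI subsetI)
  fix y assume "y \<in> ?L"
  then have y: "y \<in> V" "linked (d * N) y"
    by (simp_all add: edge_iff)
  from y(1) show "y \<in> ?R"
  proof (cases rule: VE)
    case 1
    then show ?thesis
      using y(2) by (simp add: linked_def)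
  next
    case (2 a l)
    then show ?thesis
      using y(2) not_hub N_pos by (auto simp: linked_def)
  qed
next
  fix y assume "y \<in> ?R"
  then show "y \<in> ?L"
    using in_V[of _ 0] not_hub[of _ 0] N_pos by (auto simp: edge_iff linked_def V_def)
qed

text \<open>In a block, vertex 0 misses two vertices but gains the hub, while every other vertex
  misses one: both leave \<open>N - 2 = d\<close>.\<close>

lemma card_neighbours:
  assumes "x \<in> V"
  shows "card {y. {x, y} \<in> E} = d"
  using assms
proof (cases rule: VE)
  case 1
  have "inj_on (\<lambda>i. i * N) {..<d}"
    using N_pos by (auto intro: inj_onI)
  then show ?thesis
    by (simp add: 1 neighbours_hub card_image)
next
  case (2 i j)
  let ?S = "{..<N} - insert j (non_nb j)"
  have nbx: "{y. {x, y} \<in> E} = (\<lambda>l. i * N + l) ` ?S \<union> (if j = 0 then {d * N} else {})"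
    unfolding 2(3) by (rule neighbours_block[OF 2(1,2)])
  have inj: "inj_on (\<lambda>l. i * N + l) ?S"
    by (auto intro: inj_onI)
  have sub: "insert j (non_nb j) \<subseteq> {..<N}"
    using non_nb_bound[OF 2(2)] 2(2) by simp
  have fin: "finite (non_nb j)"
    by (simp add: non_nb_def)
  have "card (insert j (non_nb j)) = Suc (card (non_nb j))"
    using fin non_nb_irrefl by simp
  then have S: "card ?S = N - Suc (card (non_nb j))"
    using sub fin by (simp add: card_Diff_subset)
  show ?thesis
  proof (cases "j = 0")
    case True
    have "d * N \<notin> (\<lambda>l. i * N + l) ` ?S"
      using not_hub[OF 2(1)] by fastforce
    then have "card {y. {x, y} \<in> E} = Suc (card ?S)"
      unfolding nbx using card_image[OF inj] True by simp
    also have "\<dots> = d"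
      using S True d by (simp add: non_nb_def N)
    finally show ?thesis .
  next
    case False
    then have "card (non_nb j) = 1"
      by (simp add: non_nb_def)
    then show ?thesis
      unfolding nbx using card_image[OF inj] S False by (simp add: N)
  qed
qed

lemma hub_simple: "finite_simple_graph V E"
  by (auto simp: finite_simple_graph_def V_def E_def linked_def)

lemma block_edge: "i < d \<Longrightarrow> j < N \<Longrightarrow> l < N \<Longrightarrow> j \<noteq> l \<Longrightarrow> l \<notin> non_nb j \<Longrightarrow> {i * N + j, i * N + l} \<in> E"
  by (simp add: edge_iff in_V linked_def)

text \<open>Within a block only vertices 1 and 2 are not adjacent to vertex 0, and they reach it
  through vertex 3.\<close>

lemma reach_hub:
  assumes "x \<in> V"
  shows "(x, d * N) \<in> reach E"
  using assms
proof (cases rule: VE)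
  case (2 i j)
  have "{i * N + 0, d * N} \<in> E"
    using in_V[OF 2(1) N_pos] not_hub[OF 2(1) N_pos] by (simp add: edge_iff linked_def V_def)
  then have root: "(i * N + 0, d * N) \<in> reach E"
    by (rule reach_edge)
  have N3: "3 < N"
    using d N by simp
  have e3: "{i * N + 3, i * N + 0} \<in> E"
    by (rule block_edge) (use 2 N3 in \<open>auto simp: non_nb_def\<close>)
  have "(i * N + j, i * N + 0) \<in> reach E"
  proof (cases "j \<le> 2")
    case True
    show ?thesis
    proof (cases "j = 0")
      case False
      then have "{i * N + j, i * N + 3} \<in> E"
        using block_edge[of i j 3] 2 N3 True by (auto simp: non_nb_def)
      then show ?thesis
        by (rule reach_trans[OF reach_edge reach_edge[OF e3]])
    qed simp
  next
    case False
    have "{i * N + j, i * N + 0} \<in> E"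
      by (rule block_edge) (use 2 False N_pos in \<open>auto simp: non_nb_def\<close>)
    then show ?thesis
      by (rule reach_edge)
  qed
  from reach_trans[OF this root] show ?thesis
    by (simp add: 2)
qed simp

lemma hub_connected: "connected_graph V E"
  unfolding connected_graph_def reach_def[symmetric]
  by (intro ballI reach_trans[OF reach_hub reach_sym[OF reach_hub]])

sublocale fin_conn_graph V E
  by unfold_locales (fact hub_simple hub_connected)+

lemma nb_eq: "nb x = {y. {x, y} \<in> E}"
  by (simp add: nb_def)

lemma card_nb: "x \<in> V \<Longrightarrow> card (nb x) = d"
  by (simp add: nb_eq card_neighbours)

lemma hub_regular: "regular_graph V E"
  unfolding regular_graph_def degree_card_nb using card_nb by blast

section \<open>Second moments in the hub graph\<close>

lemma bridge_in_tree:
  assumes T: "T \<in> sp_trees" and i: "i < d"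
  shows "{d * N, i * N} \<in> T"
proof (rule ccontr)
  assume no: "{d * N, i * N} \<notin> T"
  have "i * N \<in> V" "d * N \<in> V"
    using in_V[OF i N_pos] by (simp_all add: V_def)
  then have "(i * N, d * N) \<in> reach T"
    by (rule tree_reach[OF T])
  \<comment> \<open>Without its bridge a walk cannot leave block \<open>i\<close>: the quotient by
    \<open>N\<close> is invariant along it, yet the hub has quotient \<open>d\<close>.\<close>
  then have "d * N div N = i"
  proof (induction rule: reach_induct)
    case refl
    show ?case
      using N_pos by simp
  next
    case (step x y)
    have l: "linked x y"
      using step.hyps tree_subset[OF T] edge_iff by blast
    have "x \<noteq> d * N"
      using step.IH i N_pos by auto
    moreover have "\<not> (y = d * N \<and> x mod N = 0)"
    proof
      assume "y = d * N \<and> x mod N = 0"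
      moreover from this have "x = i * N"
        using step.IH by (metis add.right_neutral div_mult_mod_eq)
      ultimately show False
        using no step.hyps by (simp add: insert_commute)
    qed
    ultimately show ?case
      using l step.IH by (auto simp: linked_def)
  qed
  then show False
    using i N_pos by simp
qed

lemma second_moment_hub: "second_moment (d * N) = (real d)\<^sup>2"
proof -
  have "real (degree T (d * N)) = real d" if T: "T \<in> sp_trees" for T
  proof -
    have "(\<Sum>x\<in>nb (d * N). of_bool ({d * N, x} \<in> T)) = (\<Sum>x\<in>nb (d * N). 1 :: real)"
      using bridge_in_tree[OF T] by (intro sum.cong) (auto simp: nb_eq neighbours_hub)
    then show ?thesis
      using degree_sum[OF tree_subset[OF T]] card_nb[of "d * N"] by (simp add: V_def)
  qed
  then show ?thesis
    using card_trees_pos by (simp add: second_moment_def)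
qed

text \<open>Vertex 0 is left out because its neighbour, the hub, lies outside the block, whereas
  \<open>energy_ge_block\<close> wants all neighbours inside.\<close>

lemma second_moment_block:
  assumes i: "i < d" and j: "j < N" "0 < j"
  defines "a \<equiv> 2 * real d / (real d + 1)"
  shows "a + a\<^sup>2 - 1 - (a - 1) / (real d - 4) \<le> second_moment (i * N + j)"
proof -
  let ?v = "i * N + j"
  let ?B = "(\<lambda>l. i * N + l) ` {..<N}"
  have inj: "inj_on (\<lambda>l. i * N + l) S" for S
    by (auto intro: inj_onI)
  have B: "?B \<subseteq> V" "nb ?v \<subseteq> ?B" "card ?B = N"
    using in_V[OF i] j i by (auto simp: nb_eq neighbours_block card_image[OF inj])
  \<comment> \<open>At most the hub is lost from the \<open>d = N - 2\<close> neighbours, whence the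
    defect 3.\<close>
  have deg: "real (card ?B) - 3 \<le> real (card (nb z \<inter> ?B))" if z: "z \<in> ?B" for z
  proof -
    obtain l where l: "l < N" "z = i * N + l"
      using z by blast
    have zV: "z \<in> V"
      using in_V[OF i l(1)] l by simp
    have "nb z \<subseteq> insert (d * N) (nb z \<inter> ?B)"
      using l i by (auto simp: nb_eq neighbours_block)
    then have "card (nb z) \<le> card (insert (d * N) (nb z \<inter> ?B))"
      using finite_nb by (intro card_mono) auto
    also have "\<dots> \<le> Suc (card (nb z \<inter> ?B))"
      by (rule card_insert_le_m1) auto
    finally show ?thesis
      using card_nb[OF zV] B(3) N by simp
  qed
  \<comment> \<open>At least 1 because \<open>d \<ge> 5\<close>, as
    \<open>second_moment_regular_ge\<close> requires.\<close>
  have l: "real (card ?B) - 2 * 3 = real d - 4"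
    using B(3) N by simp
  have gap: "(real d - 4) * (\<Sum>x\<in>nb ?v. (\<phi> x)\<^sup>2) \<le> energy V adj \<phi> \<phi>"
    if "(\<Sum>x\<in>nb ?v. \<phi> x) = 0" for \<phi>
    using energy_ge_block[OF B(1,2) deg _ that] d unfolding l by simp
  show ?thesis
    unfolding a_def
    by (rule second_moment_regular_ge[OF in_V[OF i j(1)] card_nb _ _ gap]) (use d in auto)
qed

text \<open>The hub and the \<open>d * (d + 1)\<close> block vertices other than the vertices 0 are
  kept; the remaining \<open>d\<close> terms are nonnegative and dropped. In total there are
  \<open>d * (d + 2) + 1\<close> vertices.\<close>

lemma moment_ge:
  defines "a \<equiv> 2 * real d / (real d + 1)"
  shows "((real d)\<^sup>2 + real d * (real d + 1) * (a + a\<^sup>2 - 1 - (a - 1) / (real d - 4))) / (real d + 1)\<^sup>2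
    \<le> ust_degree_second_moment V E"
proof -
  let ?b = "a + a\<^sup>2 - 1 - (a - 1) / (real d - 4)"
  let ?f = "\<lambda>(i, j). i * N + j"
  let ?P = "{..<d} \<times> {1..<N}"
  have inj: "inj_on ?f ?P"
  proof (rule inj_onI, clarsimp)
    fix i j i' j' assume *: "j < N" "j' < N" "i * N + j = i' * N + j'"
    then show "i = i' \<and> j = j'"
      by (metis div_block mod_block)
  qed
  have nonneg: "0 \<le> second_moment v" for v
    by (simp add: second_moment_def sum_nonneg)
  have hub: "d * N \<notin> ?f ` ?P"
    using not_hub by force
  have "real d * (real d + 1) * ?b = (\<Sum>p\<in>?P. ?b)"
    by (simp add: card_cartesian_product N algebra_simps)
  also have "\<dots> \<le> (\<Sum>p\<in>?P. second_moment (?f p))"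
    by (intro sum_mono) (use second_moment_block in \<open>auto simp: a_def\<close>)
  also have "\<dots> = (\<Sum>v\<in>?f ` ?P. second_moment v)"
    by (rule sum.reindex_cong[OF inj, symmetric]) auto
  finally have "(real d)\<^sup>2 + real d * (real d + 1) * ?b
      \<le> (\<Sum>v\<in>insert (d * N) (?f ` ?P). second_moment v)"
    using hub by (simp add: second_moment_hub)
  also have "\<dots> \<le> (\<Sum>v\<in>V. second_moment v)"
    using in_V by (intro sum_mono2 finite_V nonneg) (auto simp: V_def)
  finally have "((real d)\<^sup>2 + real d * (real d + 1) * ?b) / real (card V) \<le> ust_degree_second_moment V E"
    unfolding ust_degree_second_moment_eq by (intro divide_right_mono) auto
  moreover have "real (card V) = (real d + 1)\<^sup>2"
    unfolding V_def card_atMost by (simp add: N algebra_simps power2_eq_square)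
  ultimately show ?thesis
    by simp
qed

end

text \<open>Here \<open>a\<close> tends to 2, so the blocks contribute 5 in the limit and the hub
  1.\<close>

lemma hub_graph_limit:
  "(\<lambda>k. let d = real (2 * k + 5); a = 2 * d / (d + 1)
    in (d\<^sup>2 + d * (d + 1) * (a + a\<^sup>2 - 1 - (a - 1) / (d - 4))) / (d + 1)\<^sup>2) \<longlonglongrightarrow> 6"
  unfolding Let_def by real_asymp

lemma ust_degree_second_moment_le:
  assumes "finite_simple_connected_regular V E"
  shows "ust_degree_second_moment V E \<le> 6"
proof -
  interpret fin_conn_graph V E
    using assms by (simp add: fin_conn_graph_def finite_simple_connected_regular_def)
  show ?thesis
    using assms by (intro second_moment_le_6) (simp add: finite_simple_connected_regular_def)
qed

lemma ust_degree_second_moment_bound_ge: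
  assumes C: "\<And>(V :: nat set) E. finite_simple_connected_regular V E \<Longrightarrow> ust_degree_second_moment V E \<le> C"
  shows "6 \<le> C"
proof (rule LIMSEQ_le_const2[OF hub_graph_limit], intro exI[of _ 0] allI impI)
  fix k :: nat
  interpret hub_graph "2 * k + 5" "2 * k + 7"
    by unfold_locales auto
  have "finite_simple_connected_regular V E"
    by (simp add: finite_simple_connected_regular_def hub_simple hub_connected hub_regular)
  from order_trans[OF moment_ge C[OF this]]
  show "(let d = real (2 * k + 5); a = 2 * d / (d + 1)
      in (d\<^sup>2 + d * (d + 1) * (a + a\<^sup>2 - 1 - (a - 1) / (d - 4))) / (d + 1)\<^sup>2) \<le> C"
    by (simp add: Let_def)
qed

theorem theorem1p4:
  shows "(\<forall>(V :: 'a set) E. finite_simple_connected_regular V E \<longrightarrow> ust_degree_second_moment V E \<le> 6)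
    \<and> (\<forall>C::real. (\<forall>(V :: nat set) E. finite_simple_connected_regular V E
                     \<longrightarrow> ust_degree_second_moment V E \<le> C) \<longrightarrow> 6 \<le> C)
    \<and> Sup {ust_degree_second_moment V E | (V :: nat set) E. finite_simple_connected_regular V E} = 6"
proof (intro conjI allI impI)
  show "ust_degree_second_moment V E \<le> 6" if "finite_simple_connected_regular V E" for V :: "'a set" and E
    by (rule ust_degree_second_moment_le[OF that])
  show "6 \<le> C" if "\<forall>(V :: nat set) E. finite_simple_connected_regular V E \<longrightarrow> ust_degree_second_moment V E \<le> C"
    for C :: real
    by (rule ust_degree_second_moment_bound_ge) (use that in blast)
  show "Sup {ust_degree_second_moment V E | (V :: nat set) E. finite_simple_connected_regular V E} = 6"
  proof (rule cSup_eq_non_empty)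
    \<comment> \<open>The smallest hub graph shows that the set is nonempty, so that its real
      supremum is meaningful.\<close>
    interpret hub_graph 5 7
      by unfold_locales auto
    have "finite_simple_connected_regular V E"
      by (simp add: finite_simple_connected_regular_def hub_simple hub_connected hub_regular)
    then show "{ust_degree_second_moment V E | (V :: nat set) E. finite_simple_connected_regular V E} \<noteq> {}"
      by blast
    show "x \<le> 6" if "x \<in> {ust_degree_second_moment V E | (V :: nat set) E. finite_simple_connected_regular V E}" for x
      using that ust_degree_second_moment_le by blast
    show "6 \<le> C" if "\<And>x. x \<in> {ust_degree_second_moment V E | (V :: nat set) E. finite_simple_connected_regular V E} \<Longrightarrow> x \<le> C" for C
      by (rule ust_degree_second_moment_bound_ge) (use that in blast)
  qed
qed

end
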